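(* Let $X=(X_1,\dots,X_n)$ be a random vector with independent components taking values in $\mathcal{Y}=\mathcal{X}_1\times\cdots\times\mathcal{X}_n$, let $f:\mathcal{Y}\to\mathbb{R}$ be measurable with $f=f(X)\in L^\infty(\mathbb{P})$, let $d\in\mathbb{N}$ and set $C:=217d^2$. Then for every $t\ge 0$, \[ \mathbb{P}\big(|f-\mathbb{E}f|\ge t\big)\le 2\exp\Big(-\frac1C\min\Big(\min_{k=1,\dots,d-1}\Big(\frac{t}{\|\mathfrak{h}^{(k)}f\|_{\mathrm{op},1}}\Big)^{2/k},\ \Big(\frac{t}{\|\mathfrak{h}^{(d)}f\|_{\mathrm{op},\infty}}\Big)^{2/d}\Big)\Big). \]
   Context: Let $X'=(X_1',\dots,X_n')$ be an independent copy of $X$ on the same probability space. For $i\in[n]$ and measurable $f$ with $f(X)$ bounded, $T_if(X)=f(X_1,\dots,X_{i-1},X_i',X_{i+1},\dots,X_n)$, and for distinct $i_1,\dots,i_k$, $T_{i_1\dots i_k}=T_{i_1}\circ\cdots\circ T_{i_k}$ (replacing $X_{i_1},\dots,X_{i_k}$ by $X'_{i_1},\dots,X'_{i_k}$). For distinct $i_1,\dots,i_k$ set $\mathfrak{h}_{i_1\dots i_k}f(X)=\big\|\prod_{s=1}^k(\mathrm{Id}-T_{i_s})f(X)\big\|_{i_1,\dots,i_k,\infty}=\big\|f(X)+\sum_{l=1}^k(-1)^l\sum_{1\le s_1<\dots<s_l\le k}T_{i_{s_1}\dots i_{s_l}}f(X)\big\|_{i_1,\dots,i_k,\infty}$, where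 $\|\cdot\|_{i_1,\dots,i_k,\infty}$ is the $L^\infty$-norm with respect to $X_{i_1},\dots,X_{i_k},X'_{i_1},\dots,X'_{i_k}$. The $k$-tensor $\mathfrak{h}^{(k)}f$ has entries $\mathfrak{h}_{i_1\dots i_k}f$ if $i_1,\dots,i_k$ are distinct and $0$ otherwise. For a $k$-tensor $A$, $|A|_{\mathrm{op}}=\sup_{v^1,\dots,v^k\in\mathbb{R}^n,|v^j|\le1}\sum_{i_1,\dots,i_k}v^1_{i_1}\cdots v^k_{i_k}A_{i_1\dots i_k}$, and for a random tensor $\|A\|_{\mathrm{op},p}=(\mathbb{E}|A|_{\mathrm{op}}^p)^{1/p}$ ($p=\infty$: essential supremum). Terms with zero denominator are interpreted as $+\infty$.
   Formalization: A term with zero denominator is read as +∞ only for t>0; at t=0 it is read as 0, since for almost surely constant f and t=0 the literal convention would claim 1 ≤ 0. *)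

theory Defs
  imports "HOL-Probability.Probability"
begin

text \<open>Setting: a probability space M, components X i (i < n) with values in the
measurable spaces S i (a common carrier type 'a), independent.  The law of X i is
law M S X i.  f is a function on the product space PiM {..<n} S.\<close>

definition law :: "'w measure \<Rightarrow> (nat \<Rightarrow> 'a measure) \<Rightarrow> (nat \<Rightarrow> 'w \<Rightarrow> 'a) \<Rightarrow> nat \<Rightarrow> 'a measure" where
  "law M S X i = distr M (S i) (X i)"

definition Xvec :: "nat \<Rightarrow> (nat \<Rightarrow> 'w \<Rightarrow> 'a) \<Rightarrow> 'w \<Rightarrow> nat \<Rightarrow> 'a" where
  "Xvec n X \<omega> = (\<lambda>i\<in>{..<n}. X i \<omega>)"

definition subst_coords :: "nat set \<Rightarrow> nat set \<Rightarrow> (nat \<Rightarrow> 'a) \<Rightarrow> (nat \<Rightarrow> 'a) \<Rightarrow> (nat \<Rightarrow> 'a) \<Rightarrow> nat \<Rightarrow> 'a" where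
  "subst_coords I J y x x' = (\<lambda>i. if i \<in> J then x' i else if i \<in> I then x i else y i)"

text \<open>prod_{s in I} (Id - T_s) f, evaluated at y with the coordinates in I replaced by x
(the copies X_I) and where T_J replaces them by x' (the copies X'_J).\<close>
definition diff_op :: "nat set \<Rightarrow> ((nat \<Rightarrow> 'a) \<Rightarrow> real) \<Rightarrow> (nat \<Rightarrow> 'a) \<Rightarrow> (nat \<Rightarrow> 'a) \<Rightarrow> (nat \<Rightarrow> 'a) \<Rightarrow> real" where
  "diff_op I f y x x' = (\<Sum>J\<in>Pow I. (-1) ^ card J * f (subst_coords I J y x x'))"

definition hcoef :: "'w measure \<Rightarrow> (nat \<Rightarrow> 'a measure) \<Rightarrow> (nat \<Rightarrow> 'w \<Rightarrow> 'a) \<Rightarrow> ((nat \<Rightarrow> 'a) \<Rightarrow> real)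
    \<Rightarrow> nat set \<Rightarrow> (nat \<Rightarrow> 'a) \<Rightarrow> ereal" where
  "hcoef M S X f I y =
     esssup ((PiM I (law M S X)) \<Otimes>\<^sub>M (PiM I (law M S X)))
       (\<lambda>(x, x'). ereal \<bar>diff_op I f y x x'\<bar>)"

definition idx :: "nat \<Rightarrow> nat \<Rightarrow> nat list set" where
  "idx n k = {is. length is = k \<and> set is \<subseteq> {..<n}}"

definition htensor :: "'w measure \<Rightarrow> (nat \<Rightarrow> 'a measure) \<Rightarrow> (nat \<Rightarrow> 'w \<Rightarrow> 'a) \<Rightarrow> nat
    \<Rightarrow> ((nat \<Rightarrow> 'a) \<Rightarrow> real) \<Rightarrow> 'w \<Rightarrow> nat list \<Rightarrow> real" where
  "htensor M S X n f \<omega> is =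
     (if distinct is then real_of_ereal (hcoef M S X f (set is) (Xvec n X \<omega>)) else 0)"

definition opnorm :: "nat \<Rightarrow> nat \<Rightarrow> (nat list \<Rightarrow> real) \<Rightarrow> real" where
  "opnorm n k A = Sup {(\<Sum>is\<in>idx n k. (\<Prod>j<k. v j (is ! j)) * A is) | v.
       \<forall>j<k. sqrt (\<Sum>i<n. (v j i)\<^sup>2) \<le> 1}"

definition opnorm1 :: "'w measure \<Rightarrow> nat \<Rightarrow> nat \<Rightarrow> ('w \<Rightarrow> nat list \<Rightarrow> real) \<Rightarrow> ereal" where
  "opnorm1 M n k A = enn2ereal (\<integral>\<^sup>+ \<omega>. ennreal (opnorm n k (A \<omega>)) \<partial>M)"

definition opnorminf :: "'w measure \<Rightarrow> nat \<Rightarrow> nat \<Rightarrow> ('w \<Rightarrow> nat list \<Rightarrow> real) \<Rightarrow> ereal" where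
  "opnorminf M n k A = esssup M (\<lambda>\<omega>. ereal (opnorm n k (A \<omega>)))"

text \<open>(t / a)^(2/k), with a zero denominator read as +infinity (for t > 0; for t = 0 the
term is 0 = (0/a)^(2/k)).\<close>
definition rterm :: "real \<Rightarrow> ereal \<Rightarrow> nat \<Rightarrow> ereal" where
  "rterm t a k = (if a = 0 \<and> t > 0 then \<infinity> else ereal ((t / real_of_ereal a) powr (2 / real k)))"

end

theory Submission
  imports Defs
begin

text \<open>
  Let \<open>X'\<close> be an independent copy of \<open>X\<close>, and for a set \<open>A\<close> of coordinates let \<open>X^A\<close> be \<open>X\<close> with the
  coordinates in \<open>A\<close> taken from \<open>X'\<close>. For \<open>g = (W - E W)\<^sub>+\<close> the moment \<open>E g^(2q) = Cov(W, g^(2q-1))\<close> is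
  the telescoping sum of \<open>E (W(X^A) - W(X^(A+i))) g(X)^(2q-1)\<close> averaged over all chains
  from the empty set to the full one. Symmetrizing in \<open>X\<^sub>i, X'\<^sub>i\<close>, AM-GM and Young's inequality give
  \<open>E g^(2q) \<le> (4q)^q E V^q\<close> as soon as \<open>V\<close> dominates the sum of the squared one-sided differences of \<open>W\<close>.
  For \<open>W = |h^(k) f|_op\<close> one may take \<open>V = |h^(k+1) f|_op\<^sup>2\<close>, and for \<open>W = f\<close> or \<open>-f\<close> one may take
  \<open>V = |h^(1) f|_op\<^sup>2\<close>. Iterating \<open>W \<le> E W + (W - E W)\<^sub>+\<close> up to \<open>k = d\<close> bounds the moments of \<open>f - E f\<close>, and
  Markov's inequality with \<open>q\<close> of order \<open>m\<close> finishes the proof, with a constant that does not depend on \<open>d\<close>.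
\<close>

subsection \<open>Resampling coordinates\<close>

text \<open>A single chain is not enough: its step at i differences W at a mixture
  \<open>X^A\<close> whose A changes with i, so the squared differences never meet at one point
  where V bounds their sum. Over all chains the terms can be regrouped, by A for the squares taken
  at \<open>X^A\<close> and by i for those taken at X. Unweighted, the first grouping has mass 1 +
  1/2 + ... + 1/n and the second has mass 1; letting the AM-GM weight depend on the size of A brings
  both to at most 2, so no log n is lost. Positive parts are forced by the norms: maximizing vectors
  at X control how far the norm falls when a coordinate is resampled, not how far it rises. The
  constant does not grow with d because the k-th norm is measured on the scale t r^k with r = 1 /
  sqrt (32 q): the extra r^2 of the next level absorbs both 4q and the square of the factor 2 lost
  in splitting mean and fluctuation. A separate obstacle is that a coefficient at y ignores null
  sets of copies that depend on y, so comparing y with a resampled y needs Fubini arguments for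
  almost everywhere statements.\<close>

definition mix :: "'i set \<Rightarrow> ('i \<Rightarrow> 'a) \<Rightarrow> ('i \<Rightarrow> 'a) \<Rightarrow> 'i \<Rightarrow> 'a" where
  "mix A x x' = (\<lambda>i. if i \<in> A then x' i else x i)"

definition swap_on :: "'i set \<Rightarrow> ('i \<Rightarrow> 'a) \<times> ('i \<Rightarrow> 'a) \<Rightarrow> ('i \<Rightarrow> 'a) \<times> ('i \<Rightarrow> 'a)" where
  "swap_on A = (\<lambda>(x, x'). (mix A x x', mix A x' x))"

lemma mix_empty [simp]: "mix {} x x' = x"
  by (simp add: mix_def)

lemma swap_on_Pair [simp]: "swap_on A (x, x') = (mix A x x', mix A x' x)"
  by (simp add: swap_on_def)

lemma measurable_mix [measurable (raw)]:
  assumes "g \<in> N \<rightarrow>\<^sub>M PiM I M" "h \<in> N \<rightarrow>\<^sub>M PiM I M"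
  shows "(\<lambda>z. mix A (g z) (h z)) \<in> N \<rightarrow>\<^sub>M PiM I M"
proof (rule measurable_PiM_single')
  show "(\<lambda>z. mix A (g z) (h z)) \<in> space N \<rightarrow> (\<Pi>\<^sub>E i\<in>I. space (M i))"
    using measurable_space[OF assms(1)] measurable_space[OF assms(2)]
    by (fastforce simp: mix_def space_PiM PiE_iff extensional_def)
  fix i assume i: "i \<in> I"
  show "(\<lambda>z. mix A (g z) (h z) i) \<in> N \<rightarrow>\<^sub>M M i"
    using measurable_compose[OF assms(1) measurable_component_singleton[OF i]]
      measurable_compose[OF assms(2) measurable_component_singleton[OF i]]
    by (auto simp: mix_def)
qed

lemma measurable_swap_on [measurable]:
  "swap_on A \<in> PiM I M \<Otimes>\<^sub>M PiM I M \<rightarrow>\<^sub>M PiM I M \<Otimes>\<^sub>M PiM I M"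
  unfolding swap_on_def by measurable

context finite_product_prob_space
begin

abbreviation P where "P \<equiv> PiM I M"

lemma pair_prob_space_P: "pair_prob_space P P"
  by (simp add: pair_prob_space_def pair_sigma_finite_def prob_space_axioms
      prob_space_imp_sigma_finite)

lemma prob_space_pair: "prob_space (P \<Otimes>\<^sub>M P)"
  by (intro prob_space_pair prob_space_axioms)

text \<open>The pair is one product over \<open>I \<times> UNIV\<close>, the boolean telling the two
  copies apart. There the swap is a permutation of indices, and reindexing preserves a product
  law.\<close>

lemma distr_swap_on: "distr (P \<Otimes>\<^sub>M P) (P \<Otimes>\<^sub>M P) (swap_on A) = P \<Otimes>\<^sub>M P"
proof -
  define L where "L = (\<lambda>j::'a \<times> bool. M (fst j))"
  define K where "K = I \<times> (UNIV :: bool set)"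
  define J where "J b = I \<times> {b::bool}" for b
  define r where "r b \<omega> = (\<lambda>i\<in>I. \<omega> (i, b))" for b and \<omega> :: "'a \<times> bool \<Rightarrow> 'b"
  define \<Phi> where "\<Phi> \<omega> = (r False \<omega>, r True \<omega>)" for \<omega> :: "'a \<times> bool \<Rightarrow> 'b"
  \<comment> \<open>\<open>\<pi>\<close> flips the copy label over A. The factor \<open>L j\<close>
    depends only on \<open>fst j\<close>, so indices with equal factors are exchanged.\<close>
  define \<pi> where "\<pi> j = (fst j, if fst j \<in> A then \<not> snd j else snd j)" for j :: "'a \<times> bool"
  interpret L: product_prob_space L K
    unfolding L_def by (rule product_prob_spaceI) (rule prob_space)
  have KJ: "K = J False \<union> J True" by (auto simp: K_def J_def)
  have fin: "finite (J b)" for b using finite_index by (simp add: J_def)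
  have r_meas: "r b \<in> PiM (J b) L \<rightarrow>\<^sub>M P" for b
    unfolding r_def
  proof (rule measurable_restrict)
    fix i assume "i \<in> I"
    then show "(\<lambda>\<omega>. \<omega> (i, b)) \<in> PiM (J b) L \<rightarrow>\<^sub>M M i"
      using measurable_component_singleton[of "(i, b)" "J b" L] by (simp add: J_def L_def)
  qed
  have rK_meas: "r b \<in> PiM K L \<rightarrow>\<^sub>M P" for b
    unfolding r_def
  proof (rule measurable_restrict)
    fix i assume "i \<in> I"
    then show "(\<lambda>\<omega>. \<omega> (i, b)) \<in> PiM K L \<rightarrow>\<^sub>M M i"
      using measurable_component_singleton[of "(i, b)" K L] by (simp add: K_def L_def)
  qed
  have \<Phi>_meas [measurable]: "\<Phi> \<in> PiM K L \<rightarrow>\<^sub>M P \<Otimes>\<^sub>M P"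
    unfolding \<Phi>_def using rK_meas by measurable
  have r_distr: "distr (PiM (J b) L) P (r b) = P" for b
    using distr_PiM_reindex[of "J b" L "\<lambda>i. (i, b)" I]
    by (simp add: inj_on_def J_def L_def r_def[abs_def] prob_space)
  have "P \<Otimes>\<^sub>M P = distr (PiM (J False) L) P (r False) \<Otimes>\<^sub>M distr (PiM (J True) L) P (r True)"
    by (simp add: r_distr)
  also have "\<dots> = distr (PiM (J False) L \<Otimes>\<^sub>M PiM (J True) L) (P \<Otimes>\<^sub>M P) (\<lambda>(x, y). (r False x, r True y))"
    by (intro pair_measure_distr r_meas) (simp add: r_distr prob_space_axioms prob_space_imp_sigma_finite)
  also have "\<dots> = distr (PiM (J False) L \<Otimes>\<^sub>M PiM (J True) L) (P \<Otimes>\<^sub>M P) (\<Phi> \<circ> merge (J False) (J True))"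
    by (intro distr_cong) (auto simp: \<Phi>_def r_def merge_def J_def fun_eq_iff)
  also have "\<dots> = distr (distr (PiM (J False) L \<Otimes>\<^sub>M PiM (J True) L) (PiM K L) (merge (J False) (J True))) (P \<Otimes>\<^sub>M P) \<Phi>"
    unfolding KJ by (rule distr_distr[symmetric]) (use \<Phi>_meas in \<open>auto simp: KJ intro: measurable_merge\<close>)
  also have "distr (PiM (J False) L \<Otimes>\<^sub>M PiM (J True) L) (PiM K L) (merge (J False) (J True)) = PiM K L"
    unfolding KJ by (rule L.distr_merge) (auto simp: J_def finite_index)
  finally have PP: "P \<Otimes>\<^sub>M P = distr (PiM K L) (P \<Otimes>\<^sub>M P) \<Phi>" .
  define s where "s \<omega> = (\<lambda>j\<in>K. \<omega> (\<pi> j))" for \<omega> :: "'a \<times> bool \<Rightarrow> 'b"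
  have L\<pi>: "L (\<pi> j) = L j" for j by (simp add: L_def \<pi>_def)
  have inj: "inj_on \<pi> K" by (auto simp: inj_on_def \<pi>_def split: if_splits)
  have s_distr: "distr (PiM K L) (PiM K L) s = PiM K L"
    using distr_PiM_reindex[of K L \<pi> K, unfolded L\<pi>] inj L.prob_space
    by (simp add: s_def[abs_def] K_def Pi_iff mem_Times_iff) (simp add: \<pi>_def)
  have s_meas: "s \<in> PiM K L \<rightarrow>\<^sub>M PiM K L"
    unfolding s_def by (rule measurable_restrict, subst L\<pi>[symmetric], rule measurable_component_singleton)
      (simp add: K_def \<pi>_def mem_Times_iff)
  have "distr (P \<Otimes>\<^sub>M P) (P \<Otimes>\<^sub>M P) (swap_on A) = distr (PiM K L) (P \<Otimes>\<^sub>M P) (swap_on A \<circ> \<Phi>)"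
    by (subst PP) (rule distr_distr, auto)
  also have "\<dots> = distr (PiM K L) (P \<Otimes>\<^sub>M P) (\<Phi> \<circ> s)"
    by (intro distr_cong) (auto simp: \<Phi>_def r_def s_def mix_def \<pi>_def K_def fun_eq_iff)
  also have "\<dots> = distr (distr (PiM K L) (PiM K L) s) (P \<Otimes>\<^sub>M P) \<Phi>"
    by (rule distr_distr[symmetric]) (auto intro: s_meas)
  also have "\<dots> = P \<Otimes>\<^sub>M P" by (simp add: s_distr PP[symmetric])
  finally show ?thesis .
qed

lemma integral_swap_on:
  fixes g :: "_ \<Rightarrow> real"
  assumes [measurable]: "g \<in> borel_measurable (P \<Otimes>\<^sub>M P)"
  shows "(\<integral>z. g (swap_on A z) \<partial>(P \<Otimes>\<^sub>M P)) = (\<integral>z. g z \<partial>(P \<Otimes>\<^sub>M P))"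
  using integral_distr[of "swap_on A" "P \<Otimes>\<^sub>M P" "P \<Otimes>\<^sub>M P" g] by (simp add: distr_swap_on)

lemma AE_swap_on:
  assumes "AE z in P \<Otimes>\<^sub>M P. Q z"
  shows "AE z in P \<Otimes>\<^sub>M P. Q (swap_on A z)"
proof (rule AE_distrD[where P = Q and f = "swap_on A" and M' = "P \<Otimes>\<^sub>M P"])
  show "AE z in distr (P \<Otimes>\<^sub>M P) (P \<Otimes>\<^sub>M P) (swap_on A). Q z"
    unfolding distr_swap_on by (rule assms)
qed simp

text \<open>The mixed point is the first component of the swapped pair, so its law is a marginal of
  an invariant law.\<close>

lemma distr_mix: "distr (P \<Otimes>\<^sub>M P) P (\<lambda>z. mix A (fst z) (snd z)) = P"
proof -
  have "distr (P \<Otimes>\<^sub>M P) P (fst \<circ> swap_on A) = distr (distr (P \<Otimes>\<^sub>M P) (P \<Otimes>\<^sub>M P) (swap_on A)) P fst"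
    by (rule distr_distr[symmetric]) auto
  also have "\<dots> = P"
    unfolding distr_swap_on by (rule distr_pair_fst)
  finally show ?thesis
    by (simp add: comp_def swap_on_def split_beta)
qed

lemma AE_mix:
  assumes "AE x in P. Q x"
  shows "AE z in P \<Otimes>\<^sub>M P. Q (mix A (fst z) (snd z))"
proof (rule AE_distrD[where P = Q and f = "\<lambda>z. mix A (fst z) (snd z)" and M' = P])
  show "AE z in distr (P \<Otimes>\<^sub>M P) P (\<lambda>z. mix A (fst z) (snd z)). Q z"
    unfolding distr_mix by (rule assms)
qed simp

lemma integral_mix:
  fixes g :: "_ \<Rightarrow> real"
  assumes [measurable]: "g \<in> borel_measurable P"
  shows "(\<integral>z. g (mix A (fst z) (snd z)) \<partial>(P \<Otimes>\<^sub>M P)) = (\<integral>x. g x \<partial>P)"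
  using integral_distr[of "\<lambda>z. mix A (fst z) (snd z)" "P \<Otimes>\<^sub>M P" P g] by (simp add: distr_mix)

end

subsection \<open>Averaging over chains of subsets\<close>

text \<open>Young's inequality for the exponents q + 1 and (q + 1) / q, cleared of fractions. The
  induction step only needs 2uv - u^2 <= v^2.\<close>

lemma young_power:
  fixes u v :: real
  assumes "0 \<le> u" "0 \<le> v"
  shows "real (Suc q) * (v * u ^ q) \<le> v ^ Suc q + real q * u ^ Suc q"
proof (induction q)
  case (Suc q)
  have "v * (real (Suc q) * (v * u ^ q)) \<le> v * (v ^ Suc q + real q * u ^ Suc q)"
    using Suc assms by (intro mult_left_mono)
  moreover have "real (Suc q) * u ^ q * (2 * u * v - u\<^sup>2) \<le> real (Suc q) * u ^ q * v\<^sup>2"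
    using assms zero_le_power2[of "u - v"] by (intro mult_left_mono) (auto simp: power2_diff)
  ultimately show ?case
    by (simp add: algebra_simps power2_eq_square)
qed simp

text \<open>Convexity: the slope at the larger argument bounds the increment.\<close>

lemma power_diff_le:
  fixes a b :: real
  assumes "0 \<le> b" "b \<le> a"
  shows "a ^ Suc m - b ^ Suc m \<le> real (Suc m) * (a - b) * a ^ m"
proof (induction m)
  case (Suc m)
  have "a * (a ^ Suc m - b ^ Suc m) \<le> a * (real (Suc m) * (a - b) * a ^ m)"
    using Suc assms by (intro mult_left_mono) auto
  moreover have "(a - b) * b ^ Suc m \<le> (a - b) * a ^ Suc m"
    using assms by (intro mult_left_mono power_mono) auto
  ultimately show ?case by (simp add: algebra_simps)
qed simp

lemma sum_Pow_card:
  fixes g :: "nat \<Rightarrow> real"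
  assumes "finite S"
  shows "(\<Sum>A\<in>Pow S. g (card A)) = (\<Sum>b\<le>card S. real (card S choose b) * g b)"
proof -
  have "(\<Sum>A\<in>Pow S. g (card A)) = (\<Sum>b\<le>card S. \<Sum>A\<in>{A\<in>Pow S. card A = b}. g (card A))"
    using assms by (intro sum.group[symmetric]) (auto intro: card_mono)
  also have "\<dots> = (\<Sum>b\<le>card S. real (card S choose b) * g b)"
    using n_subsets[OF assms] by (intro sum.cong) auto
  finally show ?thesis .
qed

lemma sum_Pow_Diff_swap:
  assumes "finite S"
  shows "(\<Sum>i\<in>S. \<Sum>A\<in>Pow (S - {i}). H i A) = (\<Sum>A\<in>Pow S. \<Sum>i\<in>S - A. H i A)"
proof -
  have "Pow (S - {i}) = {A\<in>Pow S. i \<notin> A}" for i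
    by auto
  then have "(\<Sum>i\<in>S. \<Sum>A\<in>Pow (S - {i}). H i A) = (\<Sum>i\<in>S. \<Sum>A\<in>{A\<in>Pow S. i \<notin> A}. H i A)"
    by simp
  also have "\<dots> = (\<Sum>A\<in>Pow S. \<Sum>i\<in>{i\<in>S. i \<notin> A}. H i A)"
    using assms by (intro sum.swap_restrict) auto
  also have "\<dots> = (\<Sum>A\<in>Pow S. \<Sum>i\<in>S - A. H i A)"
    by (simp only: set_diff_eq)
  finally show ?thesis .
qed

text \<open>A chain edge from A to \<open>insert i A\<close> is indexed by its upper end here, and
  by its lower end in the preceding lemma.\<close>

lemma sum_Pow_Diff_insert_swap:
  assumes "finite S"
  shows "(\<Sum>i\<in>S. \<Sum>A\<in>Pow (S - {i}). H i (insert i A)) = (\<Sum>A\<in>Pow S. \<Sum>i\<in>A. H i A)"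
proof -
  have "(\<Sum>A\<in>Pow (S - {i}). H i (insert i A)) = (\<Sum>A\<in>{A\<in>Pow S. i \<in> A}. H i A)" if "i \<in> S" for i
    by (rule sum.reindex_bij_witness[of _ "\<lambda>A. A - {i}" "insert i"]) (use that in auto)
  then have "(\<Sum>i\<in>S. \<Sum>A\<in>Pow (S - {i}). H i (insert i A)) = (\<Sum>i\<in>S. \<Sum>A\<in>{A\<in>Pow S. i \<in> A}. H i A)"
    by (rule sum.cong[OF refl])
  also have "\<dots> = (\<Sum>A\<in>Pow S. \<Sum>i\<in>{i\<in>S. i \<in> A}. H i A)"
    using assms by (intro sum.swap_restrict) auto
  also have "\<dots> = (\<Sum>A\<in>Pow S. \<Sum>i\<in>A. H i A)"
    by (intro sum.cong) auto
  finally show ?thesis .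
qed

text \<open>For b < n, the probability that a uniformly random maximal chain contains a given edge
  from a set of size b to one of size b + 1.\<close>

definition subset_weight :: "nat \<Rightarrow> nat \<Rightarrow> real" where
  "subset_weight n b = fact b * fact (n - Suc b) / fact n"

lemma subset_weight_nonneg: "0 \<le> subset_weight n b"
  by (simp add: subset_weight_def)

text \<open>The telescoping sum along a chain from the empty set to \<open>S\<close>, averaged over all maximal chains.\<close>

lemma subset_telescope:
  fixes F :: "'i set \<Rightarrow> real"
  assumes "finite S"
  shows "F {} - F S = (\<Sum>i\<in>S. \<Sum>A\<in>Pow (S - {i}). subset_weight (card S) (card A) * (F A - F (insert i A)))"
proof (cases "S = {}")
  case False
  define n where "n = card S"
  have n: "n > 0" using False assms by (auto simp: n_def card_gt_0_iff)
  \<comment> \<open>\<open>c b\<close> is the reciprocal of \<open>n choose b\<close>, the chance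
    that the random chain visits a given set of size b. A set strictly between the ends is entered
    and left with this same mass, so only the ends survive.\<close>
  define c where "c b = (fact b * fact (n - b) / fact n :: real)" for b
  have c1: "real (n - b) * subset_weight n b = (if b < n then c b else 0)" for b
  proof (cases "b < n")
    case True
    then have "fact (n - b) = real (n - b) * fact (n - Suc b)"
      by (metis Suc_diff_Suc fact_Suc of_nat_fact of_nat_mult)
    then show ?thesis using True by (simp add: subset_weight_def c_def)
  qed auto
  have c2: "real b * subset_weight n (b - 1) = (if b > 0 then c b else 0)" if "b \<le> n" for b
    using that by (cases b) (auto simp: subset_weight_def c_def algebra_simps)
  have "(\<Sum>i\<in>S. \<Sum>A\<in>Pow (S - {i}). subset_weight n (card A) * F A)
      = (\<Sum>A\<in>Pow S. real (n - card A) * subset_weight n (card A) * F A)"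
    unfolding sum_Pow_Diff_swap[OF assms] using assms
    by (intro sum.cong) (auto simp: n_def card_Diff_subset finite_subset)
  \<comment> \<open>The weight belongs to the lower end, hence \<open>card - 1\<close> once the
    upper end is the index.\<close>
  moreover have "(\<Sum>i\<in>S. \<Sum>A\<in>Pow (S - {i}). subset_weight n (card A) * F (insert i A))
      = (\<Sum>i\<in>S. \<Sum>A\<in>Pow (S - {i}). subset_weight n (card (insert i A) - 1) * F (insert i A))"
    using assms by (intro sum.cong refl) (auto simp: card_insert_if finite_subset subset_Diff_insert)
  then have "(\<Sum>i\<in>S. \<Sum>A\<in>Pow (S - {i}). subset_weight n (card A) * F (insert i A))
      = (\<Sum>A\<in>Pow S. \<Sum>i\<in>A. subset_weight n (card A - 1) * F A)"
    unfolding sum_Pow_Diff_insert_swap[OF assms, of "\<lambda>i A. subset_weight n (card A - 1) * F A"] .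
  then have "(\<Sum>i\<in>S. \<Sum>A\<in>Pow (S - {i}). subset_weight n (card A) * F (insert i A))
      = (\<Sum>A\<in>Pow S. real (card A) * subset_weight n (card A - 1) * F A)"
    by (simp add: mult.assoc)
  ultimately have "(\<Sum>i\<in>S. \<Sum>A\<in>Pow (S - {i}). subset_weight n (card A) * (F A - F (insert i A)))
      = (\<Sum>A\<in>Pow S. real (n - card A) * subset_weight n (card A) * F A
          - real (card A) * subset_weight n (card A - 1) * F A)"
    by (simp add: right_diff_distrib sum_subtractf)
  also have "\<dots> = (\<Sum>A\<in>Pow S. (if A = {} then F A else 0) - (if A = S then F A else 0))"
  proof (rule sum.cong[OF refl])
    fix A assume "A \<in> Pow S"
    then have A: "A \<subseteq> S" "finite A" "card A \<le> n"
      using assms by (auto simp: n_def finite_subset card_mono)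
    have "card A = 0 \<longleftrightarrow> A = {}" "card A < n \<longleftrightarrow> A \<noteq> S"
      using A card_subset_eq[OF assms A(1)] by (auto simp: n_def)
    moreover have "c 0 = 1" "c n = 1" by (auto simp: c_def)
    ultimately show "real (n - card A) * subset_weight n (card A) * F A
          - real (card A) * subset_weight n (card A - 1) * F A
       = (if A = {} then F A else 0) - (if A = S then F A else 0)"
      unfolding c1 c2[OF A(3)] using n False by (auto simp: n_def)
  qed
  also have "\<dots> = F {} - F S"
    using assms by (simp add: sum_subtractf)
  finally show ?thesis by (simp add: n_def)
qed simp

section \<open>Balancing the two masses of the chain average\<close>

lemma sum_inverse_sqrt_le: "(\<Sum>j=1..n. 1 / sqrt (real j)) \<le> 2 * sqrt (real n)"
proof (induction n)
  case (Suc n)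
  \<comment> \<open>AM-GM gives 1 / sqrt (n + 1) <= 2 (sqrt (n + 1) - sqrt n), and these bounds
    telescope.\<close>
  have "sqrt (real n) * sqrt (real (Suc n)) \<le> (real n + real (Suc n)) / 2"
    using arith_geo_mean_sqrt[of "real n" "real (Suc n)"] by (simp add: real_sqrt_mult)
  then have "1 \<le> 2 * (sqrt (real (Suc n)) - sqrt (real n)) * sqrt (real (Suc n))"
    by (simp add: algebra_simps)
  then have "1 / sqrt (real (Suc n)) \<le> 2 * (sqrt (real (Suc n)) - sqrt (real n))"
    by (simp add: pos_divide_le_eq)
  with Suc show ?case by simp
qed simp

text \<open>The weight in the AM-GM step: with it both masses below equal \<open>\<Sum>j=1..n. 1 / sqrt (n * j)\<close>.\<close>

definition balance :: "nat \<Rightarrow> nat \<Rightarrow> real" where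
  "balance n b = sqrt (real (n - b) / real n)"

lemma balance_nonneg: "0 \<le> balance n b"
  by (simp add: balance_def)

lemma balance_pos: "b < n \<Longrightarrow> 0 < balance n b"
  by (simp add: balance_def)

lemma sum_inverse_sqrt_mult_le: "(\<Sum>b<n. 1 / sqrt (real n * real (n - b))) \<le> 2"
proof (cases "n = 0")
  case False
  have "(\<Sum>b<n. 1 / sqrt (real n * real (n - b))) = (\<Sum>j=1..n. 1 / sqrt (real n * real j))"
    by (rule sum.reindex_bij_witness[of _ "\<lambda>j. n - j" "\<lambda>b. n - b"]) auto
  also have "\<dots> = (\<Sum>j=1..n. 1 / sqrt (real j)) / sqrt (real n)"
    by (simp add: real_sqrt_mult sum_divide_distrib mult.commute)
  also have "\<dots> \<le> 2 * sqrt (real n) / sqrt (real n)"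
    by (intro divide_right_mono sum_inverse_sqrt_le) auto
  also have "\<dots> = 2" using False by simp
  finally show ?thesis .
qed simp

lemma balance_divide:
  assumes "b < n"
  shows "balance n b / real (n - b) = 1 / sqrt (real n * real (n - b))"
    and "1 / (real n * balance n b) = 1 / sqrt (real n * real (n - b))"
proof -
  have "sqrt (a / c) / a = 1 / sqrt (c * a)" "1 / (c * sqrt (a / c)) = 1 / sqrt (c * a)"
    if "0 < a" "0 < c" for a c :: real
    using that real_sqrt_mult_self[of a] real_sqrt_mult_self[of c]
    by (simp_all add: real_sqrt_divide real_sqrt_mult field_simps)
  then show "balance n b / real (n - b) = 1 / sqrt (real n * real (n - b))"
    and "1 / (real n * balance n b) = 1 / sqrt (real n * real (n - b))"
    using assms unfolding balance_def by simp_all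
qed

text \<open>Every maximal chain leaves level b by exactly one of the (n choose b) (n - b) edges
  going up, all of which are equally likely.\<close>

lemma choose_mult_subset_weight:
  assumes "b < n"
  shows "real (n choose b) * subset_weight n b = 1 / real (n - b)"
proof -
  have "fact (n - b) = real (n - b) * fact (n - Suc b)"
    using assms by (metis Suc_diff_Suc fact_Suc of_nat_fact of_nat_mult)
  then show ?thesis
    using assms by (simp add: binomial_fact subset_weight_def)
qed

text \<open>Without \<open>balance\<close> level b contributes 1 / (n - b), a harmonic sum; the
  square root makes the total bounded uniformly in n.\<close>

lemma sum_weight_balance_le:
  assumes "finite S"
  shows "(\<Sum>A\<in>Pow S. subset_weight (card S) (card A) * balance (card S) (card A)) \<le> 2"
proof -
  define n where "n = card S"
  have "(\<Sum>A\<in>Pow S. subset_weight n (card A) * balance n (card A))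
      = (\<Sum>b\<le>n. real (n choose b) * (subset_weight n b * balance n b))"
    using sum_Pow_card[OF assms] by (simp add: n_def)
  \<comment> \<open>The level b = n is dropped here: truncated subtraction makes
    \<open>subset_weight n n\<close> equal to 1, but \<open>balance n n\<close> is 0.\<close>
  also have "\<dots> = (\<Sum>b<n. real (n choose b) * (subset_weight n b * balance n b))"
    by (simp add: lessThan_Suc_atMost[symmetric] balance_def)
  also have "\<dots> = (\<Sum>b<n. 1 / sqrt (real n * real (n - b)))"
  proof (rule sum.cong[OF refl])
    fix b assume "b \<in> {..<n}"
    then have b: "b < n" by simp
    have "real (n choose b) * (subset_weight n b * balance n b) = balance n b / real (n - b)"
      using choose_mult_subset_weight[OF b] by (simp add: mult.assoc[symmetric])
    also have "\<dots> = 1 / sqrt (real n * real (n - b))"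
      by (rule balance_divide(1)[OF b])
    finally show "real (n choose b) * (subset_weight n b * balance n b) = 1 / sqrt (real n * real (n - b))" .
  qed
  finally show ?thesis using sum_inverse_sqrt_mult_le[of n] by (simp add: n_def)
qed

text \<open>In a random order the position of i is uniform, so each level has mass 1 / n before the
  division by \<open>balance\<close>.\<close>

lemma sum_weight_divide_balance_le:
  assumes "finite S" "i \<in> S"
  shows "(\<Sum>A\<in>Pow (S - {i}). subset_weight (card S) (card A) / balance (card S) (card A)) \<le> 2"
proof -
  define m where "m = card (S - {i})"
  have n: "card S = Suc m" using assms by (simp add: m_def card_Suc_Diff1 del: card_Diff_insert)
  have "(\<Sum>A\<in>Pow (S - {i}). subset_weight (Suc m) (card A) / balance (Suc m) (card A))
      = (\<Sum>b\<le>m. real (m choose b) * (subset_weight (Suc m) b / balance (Suc m) b))"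
    unfolding m_def using assms by (intro sum_Pow_card) simp
  also have "\<dots> = (\<Sum>b<Suc m. 1 / sqrt (real (Suc m) * real (Suc m - b)))"
  proof (rule sum.cong)
    fix b assume "b \<in> {..<Suc m}"
    then have b: "b < Suc m" by simp
    have "real (m choose b) * subset_weight (Suc m) b = 1 / real (Suc m)"
      using b by (simp add: binomial_fact subset_weight_def del: of_nat_Suc) 
    then have "real (m choose b) * (subset_weight (Suc m) b / balance (Suc m) b) = 1 / (real (Suc m) * balance (Suc m) b)"
      by (metis divide_divide_eq_left times_divide_eq_right)
    also have "\<dots> = 1 / sqrt (real (Suc m) * real (Suc m - b))"
      by (rule balance_divide(2)[OF b])
    finally show "real (m choose b) * (subset_weight (Suc m) b / balance (Suc m) b) = 1 / sqrt (real (Suc m) * real (Suc m - b))" .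
  qed auto
  finally show ?thesis using sum_inverse_sqrt_mult_le[of "Suc m"] by (simp add: n)
qed

subsection \<open>The one-sided moment inequality\<close>

text \<open>Bounds are asked for almost everywhere only, because f and its tensors are bounded only
  outside null sets. The class is closed under the operations used below, so integrability follows
  from introduction rules.\<close>

definition ess_bdd :: "'a measure \<Rightarrow> ('a \<Rightarrow> real) \<Rightarrow> bool" where
  "ess_bdd M g \<longleftrightarrow> g \<in> borel_measurable M \<and> (\<exists>B. AE x in M. \<bar>g x\<bar> \<le> B)"

named_theorems ess_bdd_intros

lemma ess_bddI: "g \<in> borel_measurable M \<Longrightarrow> AE x in M. \<bar>g x\<bar> \<le> B \<Longrightarrow> ess_bdd M g"
  by (auto simp: ess_bdd_def)

lemma ess_bdd_measurable: "ess_bdd M g \<Longrightarrow> g \<in> borel_measurable M"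
  by (simp add: ess_bdd_def)

lemma ess_bdd_const [ess_bdd_intros]: "ess_bdd M (\<lambda>x. c)"
  by (rule ess_bddI[of _ _ "\<bar>c\<bar>"]) auto

lemma ess_bdd_add [ess_bdd_intros]:
  assumes "ess_bdd M g" "ess_bdd M h"
  shows "ess_bdd M (\<lambda>x. g x + h x)"
proof -
  obtain B B' where "AE x in M. \<bar>g x\<bar> \<le> B" "AE x in M. \<bar>h x\<bar> \<le> B'"
    using assms by (auto simp: ess_bdd_def)
  then have "AE x in M. \<bar>g x + h x\<bar> \<le> B + B'"
    by eventually_elim auto
  then show ?thesis using assms by (intro ess_bddI) (auto simp: ess_bdd_def)
qed

lemma ess_bdd_mult [ess_bdd_intros]:
  assumes "ess_bdd M g" "ess_bdd M h"
  shows "ess_bdd M (\<lambda>x. g x * h x)"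
proof -
  obtain B B' where "AE x in M. \<bar>g x\<bar> \<le> B" "AE x in M. \<bar>h x\<bar> \<le> B'"
    using assms by (auto simp: ess_bdd_def)
  then have "AE x in M. \<bar>g x * h x\<bar> \<le> B * B'"
    by eventually_elim (auto simp: abs_mult intro!: mult_mono)
  then show ?thesis using assms by (intro ess_bddI) (auto simp: ess_bdd_def)
qed

lemma ess_bdd_uminus [ess_bdd_intros]: "ess_bdd M g \<Longrightarrow> ess_bdd M (\<lambda>x. - g x)"
  by (auto simp: ess_bdd_def)

lemma ess_bdd_diff [ess_bdd_intros]: "ess_bdd M g \<Longrightarrow> ess_bdd M h \<Longrightarrow> ess_bdd M (\<lambda>x. g x - h x)"
  using ess_bdd_add[OF _ ess_bdd_uminus] by simp

lemma ess_bdd_power [ess_bdd_intros]: "ess_bdd M g \<Longrightarrow> ess_bdd M (\<lambda>x. g x ^ k)"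
  by (induction k) (auto intro: ess_bdd_intros)

lemma ess_bdd_divide [ess_bdd_intros]: "ess_bdd M g \<Longrightarrow> ess_bdd M (\<lambda>x. g x / c)"
  using ess_bdd_mult[OF _ ess_bdd_const[of _ "inverse c"]] by (simp add: divide_inverse)

lemma ess_bdd_max0 [ess_bdd_intros]:
  assumes "ess_bdd M g"
  shows "ess_bdd M (\<lambda>x. max 0 (g x))"
proof -
  obtain B where "AE x in M. \<bar>g x\<bar> \<le> B"
    using assms by (auto simp: ess_bdd_def)
  then have "AE x in M. \<bar>max 0 (g x)\<bar> \<le> B"
    by eventually_elim auto
  then show ?thesis using assms by (intro ess_bddI) (auto simp: ess_bdd_def)
qed

lemma ess_bdd_sum [ess_bdd_intros]:
  "(\<And>i. i \<in> S \<Longrightarrow> ess_bdd M (g i)) \<Longrightarrow> ess_bdd M (\<lambda>x. \<Sum>i\<in>S. g i x)"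
  by (induction S rule: infinite_finite_induct) (auto intro: ess_bdd_intros)

lemma ess_bdd_compose:
  assumes g: "ess_bdd N g" and T: "T \<in> M \<rightarrow>\<^sub>M N" "distr M N T = N"
  shows "ess_bdd M (\<lambda>x. g (T x))"
proof -
  obtain B where "AE x in N. \<bar>g x\<bar> \<le> B" using g by (auto simp: ess_bdd_def)
  then have "AE x in distr M N T. \<bar>g x\<bar> \<le> B" by (simp only: T(2))
  then have "AE x in M. \<bar>g (T x)\<bar> \<le> B" by (rule AE_distrD[OF T(1)])
  then show ?thesis using assms by (intro ess_bddI) (auto simp: ess_bdd_def)
qed

lemma (in finite_measure) ess_bdd_integrable: "ess_bdd M g \<Longrightarrow> integrable M g"
  by (auto simp: ess_bdd_def intro!: integrable_const_bound)

section \<open>Symmetrization and the moment estimate\<close>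

context finite_product_prob_space
begin

lemma integrable_pair: "ess_bdd (P \<Otimes>\<^sub>M P) g \<Longrightarrow> integrable (P \<Otimes>\<^sub>M P) g"
  using prob_space_pair
  by (intro finite_measure.ess_bdd_integrable prob_space.finite_measure)

lemma ess_bdd_mix [ess_bdd_intros]:
  "ess_bdd P g \<Longrightarrow> ess_bdd (P \<Otimes>\<^sub>M P) (\<lambda>z. g (mix A (fst z) (snd z)))"
  by (rule ess_bdd_compose[OF _ _ distr_mix]) auto

lemma ess_bdd_fst [ess_bdd_intros]: "ess_bdd P g \<Longrightarrow> ess_bdd (P \<Otimes>\<^sub>M P) (\<lambda>z. g (fst z))"
  using ess_bdd_mix[of g "{}"] by simp

lemma ess_bdd_swap_on: "ess_bdd (P \<Otimes>\<^sub>M P) g \<Longrightarrow> ess_bdd (P \<Otimes>\<^sub>M P) (\<lambda>z. g (swap_on A z))"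
  by (rule ess_bdd_compose[OF _ _ distr_swap_on]) auto

lemma integral_fst:
  fixes g :: "_ \<Rightarrow> real"
  shows "g \<in> borel_measurable P \<Longrightarrow> (\<integral>z. g (fst z) \<partial>(P \<Otimes>\<^sub>M P)) = (\<integral>x. g x \<partial>P)"
  using integral_mix[of g "{}"] by simp

text \<open>Resampling every coordinate makes the first factor a function of the copy alone, and
  Fubini applies. This evaluates the last term of the telescoping sum.\<close>

lemma integral_mix_index_mult:
  fixes g h :: "_ \<Rightarrow> real"
  assumes "ess_bdd P g" "ess_bdd P h"
  shows "(\<integral>z. g (mix I (fst z) (snd z)) * h (fst z) \<partial>(P \<Otimes>\<^sub>M P)) = (\<integral>x. g x \<partial>P) * (\<integral>x. h x \<partial>P)"
proof -
  interpret PP: pair_sigma_finite P P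
    using pair_prob_space_P by (simp add: pair_prob_space_def)
  \<comment> \<open>Points of \<open>space P\<close> are undefined outside I, so mixing over all of
    I leaves no trace of x.\<close>
  have mix_I: "mix I x x' = x'" if "x \<in> space P" "x' \<in> space P" for x x'
    using that by (auto simp: mix_def space_PiM PiE_iff extensional_def)
  have "(\<integral>z. g (mix I (fst z) (snd z)) * h (fst z) \<partial>(P \<Otimes>\<^sub>M P)) = (\<integral>x. (\<integral>x'. g (mix I x x') * h x \<partial>P) \<partial>P)"
    using PP.integral_fst'[OF integrable_pair[of "\<lambda>z. g (mix I (fst z) (snd z)) * h (fst z)"]] assms
    by (simp add: ess_bdd_intros)
  also have "\<dots> = (\<integral>x. (\<integral>x'. g x' * h x \<partial>P) \<partial>P)"
    by (intro Bochner_Integration.integral_cong refl) (simp add: mix_I)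
  finally show ?thesis by simp
qed

text \<open>Both the difference of \<open>W\<close> at a resampled point and that of \<open>\<phi>\<close> at the original one change
  sign when the coordinate \<open>i\<close> of the two copies is swapped; hence only the part where both are
  positive matters, and there each difference is controlled at its own first argument.\<close>

lemma resampling_step:
  fixes W \<phi> :: "_ \<Rightarrow> real"
  assumes W: "ess_bdd P W" and \<phi>: "ess_bdd P \<phi>" and i: "i \<notin> A"
  defines "pos u x x' \<equiv> max 0 (u x - u (mix {i} x x') :: real)"
  shows "(\<integral>z. W (mix A (fst z) (snd z)) * \<phi> (fst z) \<partial>(P \<Otimes>\<^sub>M P))
       - (\<integral>z. W (mix (insert i A) (fst z) (snd z)) * \<phi> (fst z) \<partial>(P \<Otimes>\<^sub>M P))
     \<le> (\<integral>z. pos W (fst (swap_on A z)) (snd (swap_on A z)) * pos \<phi> (fst z) (snd z) \<partial>(P \<Otimes>\<^sub>M P))"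
proof -
  define a where "a z = W (mix A (fst z) (snd z)) - W (mix (insert i A) (fst z) (snd z))" for z
  define b where "b z = \<phi> (fst z) - \<phi> (mix {i} (fst z) (snd z))" for z
  have bdd [ess_bdd_intros]: "ess_bdd (P \<Otimes>\<^sub>M P) a" "ess_bdd (P \<Otimes>\<^sub>M P) b"
    unfolding a_def[abs_def] b_def[abs_def] by (intro ess_bdd_intros W \<phi>)+
  note int = integrable_pair
  \<comment> \<open>Swapping coordinate i of the copies exchanges the mixtures over A and over
    \<open>insert i A\<close>, which relies on \<open>i \<notin> A\<close>.\<close>
  have mix1: "mix A (mix {i} x x') (mix {i} x' x) = mix (insert i A) x x'"
    "mix (insert i A) (mix {i} x x') (mix {i} x' x) = mix A x x'"
    "mix {i} (mix {i} x x') (mix {i} x' x) = x"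
    "mix {i} (mix A x x') (mix A x' x) = mix (insert i A) x x'" for x x' :: "'a \<Rightarrow> 'b"
    using i by (auto simp: mix_def fun_eq_iff)
  have a_swap: "a (swap_on {i} z) = - a z" and b_swap: "b (swap_on {i} z) = - b z" for z
    by (cases z; simp add: a_def b_def mix1)+
  have "(\<integral>z. a z * \<phi> (fst z) \<partial>(P \<Otimes>\<^sub>M P)) = (\<integral>z. a (swap_on {i} z) * \<phi> (fst (swap_on {i} z)) \<partial>(P \<Otimes>\<^sub>M P))"
    by (rule integral_swap_on[symmetric]) (intro ess_bdd_measurable ess_bdd_intros \<phi>)
  also have "\<dots> = (\<integral>z. - (a z * \<phi> (mix {i} (fst z) (snd z))) \<partial>(P \<Otimes>\<^sub>M P))"
    by (simp add: a_swap) (simp add: swap_on_def split_beta)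
  finally have "2 * (\<integral>z. a z * \<phi> (fst z) \<partial>(P \<Otimes>\<^sub>M P))
      = (\<integral>z. a z * \<phi> (fst z) \<partial>(P \<Otimes>\<^sub>M P)) - (\<integral>z. a z * \<phi> (mix {i} (fst z) (snd z)) \<partial>(P \<Otimes>\<^sub>M P))"
    by simp
  also have "\<dots> = (\<integral>z. a z * b z \<partial>(P \<Otimes>\<^sub>M P))"
    by (subst Bochner_Integration.integral_diff[symmetric])
      (auto intro!: int ess_bdd_intros \<phi> simp: b_def algebra_simps)
  \<comment> \<open>Where a and b have opposite signs the product is at most 0 and is dropped. The
    two remaining parts are interchanged by the swap and have equal integrals.\<close>
  also have "\<dots> \<le> (\<integral>z. max 0 (a z) * max 0 (b z) + max 0 (- a z) * max 0 (- b z) \<partial>(P \<Otimes>\<^sub>M P))"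
    by (intro integral_mono int ess_bdd_intros) (auto simp: max_def mult_nonneg_nonpos mult_nonneg_nonpos2)
  also have "\<dots> = (\<integral>z. max 0 (a z) * max 0 (b z) \<partial>(P \<Otimes>\<^sub>M P)) + (\<integral>z. max 0 (- a z) * max 0 (- b z) \<partial>(P \<Otimes>\<^sub>M P))"
    by (intro Bochner_Integration.integral_add int ess_bdd_intros)
  also have "(\<integral>z. max 0 (- a z) * max 0 (- b z) \<partial>(P \<Otimes>\<^sub>M P)) = (\<integral>z. max 0 (a z) * max 0 (b z) \<partial>(P \<Otimes>\<^sub>M P))"
    unfolding a_swap[symmetric] b_swap[symmetric]
    by (rule integral_swap_on) (intro ess_bdd_measurable ess_bdd_intros)
  finally have "(\<integral>z. a z * \<phi> (fst z) \<partial>(P \<Otimes>\<^sub>M P)) \<le> (\<integral>z. max 0 (a z) * max 0 (b z) \<partial>(P \<Otimes>\<^sub>M P))"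
    by simp
  moreover have "(\<integral>z. a z * \<phi> (fst z) \<partial>(P \<Otimes>\<^sub>M P)) = (\<integral>z. W (mix A (fst z) (snd z)) * \<phi> (fst z) \<partial>(P \<Otimes>\<^sub>M P))
       - (\<integral>z. W (mix (insert i A) (fst z) (snd z)) * \<phi> (fst z) \<partial>(P \<Otimes>\<^sub>M P))"
    by (subst Bochner_Integration.integral_diff[symmetric])
      (auto intro!: int ess_bdd_intros \<phi> W simp: a_def algebra_simps)
  \<comment> \<open>\<open>a z\<close> is the one-coordinate difference of W at the mixture over A,
    which is the first component of \<open>swap_on A z\<close>.\<close>
  moreover have "max 0 (a z) * max 0 (b z) = pos W (fst (swap_on A z)) (snd (swap_on A z)) * pos \<phi> (fst z) (snd z)" for z
    by (cases z) (simp add: a_def b_def pos_def mix1)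
  ultimately show ?thesis by simp
qed

text \<open>The constant arises as 2c with c = 2q - 1: the slope of the power gives c, AM-GM halves
  it, and the two masses give 2 + 2; finally 2c <= 4q. As V depends on the first point only, its
  value at a mixture has the law of V.\<close>

lemma moment_upper_tail:
  fixes W V :: "_ \<Rightarrow> real"
  assumes W: "ess_bdd P W" and V: "ess_bdd P V" and V_nonneg: "\<And>x. 0 \<le> V x"
    and diff: "AE z in P \<Otimes>\<^sub>M P. (\<Sum>i\<in>I. (max 0 (W (fst z) - W (mix {i} (fst z) (snd z))))\<^sup>2) \<le> V (fst z)"
    and q: "q \<ge> 1"
  shows "(\<integral>x. (max 0 (W x - (\<integral>y. W y \<partial>P))) ^ (2 * q) \<partial>P) \<le> (4 * real q) ^ q * (\<integral>x. V x ^ q \<partial>P)"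
proof -
  obtain r where r: "q = Suc r" using q by (cases q) auto
  define g where "g x = max 0 (W x - (\<integral>y. W y \<partial>P))" for x
  define U where "U x = (g x)\<^sup>2" for x
  define \<phi> where "\<phi> x = g x ^ Suc (2 * r)" for x
  define D where "D i z = max 0 (W (fst z) - W (mix {i} (fst z) (snd z)))" for i z
  define F where "F A = (\<integral>z. W (mix A (fst z) (snd z)) * \<phi> (fst z) \<partial>(P \<Otimes>\<^sub>M P))" for A
  define n where "n = card I"
  define c where "c = real (Suc (2 * r))"
  have bdd [ess_bdd_intros]: "ess_bdd P g" "ess_bdd P U" "ess_bdd P \<phi>" "\<And>i. ess_bdd (P \<Otimes>\<^sub>M P) (D i)"
    unfolding g_def[abs_def] U_def[abs_def] \<phi>_def[abs_def] D_def[abs_def] by (intro ess_bdd_intros W)+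
  note bdd' [ess_bdd_intros] = W V ess_bdd_swap_on
  note int = integrable_pair
  have g_nonneg: "0 \<le> g x" and U_nonneg: "0 \<le> U x" and D_nonneg: "0 \<le> D i z" for x i z
    by (auto simp: g_def U_def D_def)
  \<comment> \<open>Below the mean both sides vanish, since \<open>\<phi>\<close> is a positive
    power of \<open>g\<close>.\<close>
  have U_q: "U x ^ q = (W x - (\<integral>y. W y \<partial>P)) * \<phi> x" for x
    by (cases "W x \<ge> (\<integral>y. W y \<partial>P)") (auto simp: r U_def \<phi>_def g_def power2_eq_square power_mult mult.assoc)
  have "(\<integral>x. U x ^ q \<partial>P) = (\<integral>x. W x * \<phi> x \<partial>P) - (\<integral>y. W y \<partial>P) * (\<integral>x. \<phi> x \<partial>P)"
    unfolding U_q left_diff_distrib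
    by (subst Bochner_Integration.integral_diff) (auto intro!: ess_bdd_integrable ess_bdd_intros)
  also have "(\<integral>x. W x * \<phi> x \<partial>P) = F {}"
    unfolding F_def by (simp add: integral_fst[of "\<lambda>x. W x * \<phi> x"] ess_bdd_measurable ess_bdd_intros)
  also have "(\<integral>y. W y \<partial>P) * (\<integral>x. \<phi> x \<partial>P) = F I"
    unfolding F_def by (rule integral_mix_index_mult[symmetric]) (intro ess_bdd_intros)+
  also have "F {} - F I = (\<Sum>i\<in>I. \<Sum>A\<in>Pow (I - {i}). subset_weight n (card A) * (F A - F (insert i A)))"
    unfolding n_def by (rule subset_telescope[OF finite_index])
  finally have tele: "(\<integral>x. U x ^ q \<partial>P) = (\<Sum>i\<in>I. \<Sum>A\<in>Pow (I - {i}). subset_weight n (card A) * (F A - F (insert i A)))" .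

  \<comment> \<open>Only a decrease of W under resampling counts, and then the slope is taken at the
    unresampled point; this puts the weight \<open>U ^ r\<close> at \<open>fst z\<close>.\<close>
  have pos_\<phi>: "max 0 (\<phi> (fst z) - \<phi> (mix {i} (fst z) (snd z))) \<le> c * (D i z * U (fst z) ^ r)" for i z
  proof (cases "W (mix {i} (fst z) (snd z)) \<le> W (fst z)")
    case True
    then have le: "g (mix {i} (fst z) (snd z)) \<le> g (fst z)"
      and "g (fst z) - g (mix {i} (fst z) (snd z)) \<le> D i z"
      by (auto simp: g_def D_def)
    then have "c * (g (fst z) - g (mix {i} (fst z) (snd z))) * g (fst z) ^ (2 * r) \<le> c * D i z * g (fst z) ^ (2 * r)"
      using g_nonneg by (intro mult_right_mono mult_left_mono) (auto simp: c_def)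
    moreover have "\<phi> (fst z) - \<phi> (mix {i} (fst z) (snd z)) \<le> c * (g (fst z) - g (mix {i} (fst z) (snd z))) * g (fst z) ^ (2 * r)"
      unfolding c_def \<phi>_def by (rule power_diff_le[OF g_nonneg le])
    moreover have "0 \<le> c * D i z * g (fst z) ^ (2 * r)"
      using g_nonneg D_nonneg by (simp add: c_def)
    ultimately show ?thesis
      by (simp add: U_def power_mult mult.assoc)
  next
    case False
    then have "\<phi> (fst z) \<le> \<phi> (mix {i} (fst z) (snd z))"
      unfolding \<phi>_def using g_nonneg by (intro power_mono) (auto simp: g_def)
    then show ?thesis using D_nonneg U_nonneg by (simp add: c_def)
  qed

  \<comment> \<open>In \<open>a\<close> the squared difference sits at the mixture while the weight
    stays at the original point; in \<open>b\<close> both sit at the original point.\<close>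
  define a where "a i A = (\<integral>z. (D i (swap_on A z))\<^sup>2 * U (fst z) ^ r \<partial>(P \<Otimes>\<^sub>M P))" for i A
  define b where "b i = (\<integral>z. (D i z)\<^sup>2 * U (fst z) ^ r \<partial>(P \<Otimes>\<^sub>M P))" for i
  have step: "F A - F (insert i A) \<le> c / 2 * (balance n (card A) * a i A + b i / balance n (card A))"
    if i: "i \<in> I" and A: "A \<in> Pow (I - {i})" for i A
  proof -
    define l where "l = balance n (card A)"
    have "A \<subset> I" using that by auto
    then have l: "0 < l" unfolding l_def n_def by (intro balance_pos psubset_card_mono finite_index)
    have "F A - F (insert i A) \<le> (\<integral>z. D i (swap_on A z) * max 0 (\<phi> (fst z) - \<phi> (mix {i} (fst z) (snd z))) \<partial>(P \<Otimes>\<^sub>M P))"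
      unfolding F_def D_def using A by (intro resampling_step) (auto intro: ess_bdd_intros)
    also have "\<dots> \<le> (\<integral>z. c / 2 * (l * ((D i (swap_on A z))\<^sup>2 * U (fst z) ^ r) + (D i z)\<^sup>2 * U (fst z) ^ r / l) \<partial>(P \<Otimes>\<^sub>M P))"
    proof (intro integral_mono int ess_bdd_intros)
      fix z
      have "0 \<le> (sqrt l * D i (swap_on A z) - D i z / sqrt l)\<^sup>2" by simp
      then have am_gm: "D i (swap_on A z) * D i z \<le> (l * (D i (swap_on A z))\<^sup>2 + (D i z)\<^sup>2 / l) / 2"
        using l by (simp add: power2_diff power_mult_distrib power_divide)
      have "D i (swap_on A z) * max 0 (\<phi> (fst z) - \<phi> (mix {i} (fst z) (snd z))) \<le> D i (swap_on A z) * (c * (D i z * U (fst z) ^ r))"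
        by (intro mult_left_mono pos_\<phi> D_nonneg)
      also have "\<dots> = c * U (fst z) ^ r * (D i (swap_on A z) * D i z)" by simp
      also have "\<dots> \<le> c * U (fst z) ^ r * ((l * (D i (swap_on A z))\<^sup>2 + (D i z)\<^sup>2 / l) / 2)"
        using U_nonneg by (intro mult_left_mono am_gm) (simp add: c_def)
      finally show "D i (swap_on A z) * max 0 (\<phi> (fst z) - \<phi> (mix {i} (fst z) (snd z)))
        \<le> c / 2 * (l * ((D i (swap_on A z))\<^sup>2 * U (fst z) ^ r) + (D i z)\<^sup>2 * U (fst z) ^ r / l)"
        by (simp add: field_simps)
    qed
    also have "\<dots> = c / 2 * (l * a i A + b i / l)"
      unfolding a_def b_def
      by (subst integral_mult_right_zero, subst Bochner_Integration.integral_add)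
        (auto intro!: int ess_bdd_intros)
    finally show ?thesis by (simp add: l_def)
  qed

  \<comment> \<open>\<open>Y\<close> is the Young bound for the integral of K V U^r with V at any
    mixture. \<open>K = 2 * c\<close> makes the final estimate equal to \<open>Y\<close>, in which
    the integral of U^q has the coefficient r / q < 1 and can be absorbed.\<close>
  define K where "K = 2 * c"
  define Y where "Y = (K ^ q * (\<integral>x. V x ^ q \<partial>P) + real r * (\<integral>x. U x ^ q \<partial>P)) / real q"
  have K: "0 < K" by (simp add: K_def c_def)
  have young: "(\<integral>z. V (mix A (fst z) (snd z)) * U (fst z) ^ r \<partial>(P \<Otimes>\<^sub>M P)) \<le> Y / K" for A
  proof -
    have pw: "real q * (K * (V (mix A (fst z) (snd z)) * U (fst z) ^ r)) \<le> K ^ q * V (mix A (fst z) (snd z)) ^ q + real r * U (fst z) ^ q" for z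
      using young_power[OF U_nonneg[of "fst z"], of "K * V (mix A (fst z) (snd z))" r] K V_nonneg
      unfolding r by (simp add: power_mult_distrib mult_ac)
    have "real q * (K * (\<integral>z. V (mix A (fst z) (snd z)) * U (fst z) ^ r \<partial>(P \<Otimes>\<^sub>M P)))
        = (\<integral>z. real q * (K * (V (mix A (fst z) (snd z)) * U (fst z) ^ r)) \<partial>(P \<Otimes>\<^sub>M P))" by simp
    also have "\<dots> \<le> (\<integral>z. K ^ q * V (mix A (fst z) (snd z)) ^ q + real r * U (fst z) ^ q \<partial>(P \<Otimes>\<^sub>M P))"
      by (intro integral_mono int ess_bdd_intros pw)
    also have "\<dots> = K ^ q * (\<integral>z. V (mix A (fst z) (snd z)) ^ q \<partial>(P \<Otimes>\<^sub>M P)) + real r * (\<integral>z. U (fst z) ^ q \<partial>(P \<Otimes>\<^sub>M P))"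
      by (subst Bochner_Integration.integral_add) (auto intro!: int ess_bdd_intros)
    also have "\<dots> = real q * Y"
      using q by (simp add: Y_def integral_fst[of "\<lambda>x. U x ^ q"] integral_mix[of "\<lambda>x. V x ^ q"] ess_bdd_measurable ess_bdd_intros)
    finally show ?thesis using q K by (simp add: field_simps)
  qed
  have Y_nonneg: "0 \<le> Y"
    unfolding Y_def using K V_nonneg U_nonneg by (intro divide_nonneg_nonneg add_nonneg_nonneg mult_nonneg_nonneg integral_nonneg) auto
  have sum_a: "(\<Sum>i\<in>I - A. a i A) \<le> Y / K" if "A \<in> Pow I" for A
  proof -
    \<comment> \<open>The indices in A are added back because the hypothesis bounds the sum over all
      of I.\<close>
    have "(\<Sum>i\<in>I - A. a i A) \<le> (\<Sum>i\<in>I. a i A)"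
      unfolding a_def using U_nonneg by (intro sum_mono2 finite_index integral_nonneg) auto
    also have "\<dots> = (\<integral>z. (\<Sum>i\<in>I. (D i (swap_on A z))\<^sup>2) * U (fst z) ^ r \<partial>(P \<Otimes>\<^sub>M P))"
      unfolding a_def sum_distrib_right
      by (rule Bochner_Integration.integral_sum[symmetric]) (intro int ess_bdd_intros)
    also have "\<dots> \<le> (\<integral>z. V (mix A (fst z) (snd z)) * U (fst z) ^ r \<partial>(P \<Otimes>\<^sub>M P))"
    proof (intro integral_mono_AE int ess_bdd_intros)
      show "AE z in P \<Otimes>\<^sub>M P. (\<Sum>i\<in>I. (D i (swap_on A z))\<^sup>2) * U (fst z) ^ r \<le> V (mix A (fst z) (snd z)) * U (fst z) ^ r"
        using AE_swap_on[OF diff, of A]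
        by eventually_elim (auto simp: D_def swap_on_def split_beta U_nonneg intro!: mult_right_mono)
    qed
    finally show ?thesis using young[of A] by simp
  qed
  have sum_b: "(\<Sum>i\<in>I. b i) \<le> Y / K"
  proof -
    have "(\<Sum>i\<in>I. b i) = (\<Sum>i\<in>I - {}. a i {})"
      by (simp add: a_def b_def swap_on_def)
    then show ?thesis using sum_a[of "{}"] by simp
  qed
  have "(\<integral>x. U x ^ q \<partial>P) \<le> (\<Sum>i\<in>I. \<Sum>A\<in>Pow (I - {i}). subset_weight n (card A) * (c / 2 * (balance n (card A) * a i A + b i / balance n (card A))))"
    unfolding tele by (intro sum_mono mult_left_mono step subset_weight_nonneg) auto
  also have "\<dots> = c / 2 * ((\<Sum>i\<in>I. \<Sum>A\<in>Pow (I - {i}). subset_weight n (card A) * balance n (card A) * a i A)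
       + (\<Sum>i\<in>I. \<Sum>A\<in>Pow (I - {i}). subset_weight n (card A) / balance n (card A) * b i))"
    by (simp add: sum_distrib_left sum.distrib[symmetric] algebra_simps)
  \<comment> \<open>Grouped by A, all differences sit at the same mixture; the terms with
    \<open>b i\<close> are grouped by i further down.\<close>
  also have "(\<Sum>i\<in>I. \<Sum>A\<in>Pow (I - {i}). subset_weight n (card A) * balance n (card A) * a i A)
      = (\<Sum>A\<in>Pow I. subset_weight n (card A) * balance n (card A) * (\<Sum>i\<in>I - A. a i A))"
    unfolding sum_Pow_Diff_swap[OF finite_index] by (simp add: sum_distrib_left)
  also have "\<dots> \<le> (\<Sum>A\<in>Pow I. subset_weight n (card A) * balance n (card A) * (Y / K))"
    by (intro sum_mono mult_left_mono sum_a mult_nonneg_nonneg subset_weight_nonneg balance_nonneg)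
  also have "\<dots> \<le> 2 * (Y / K)"
    unfolding sum_distrib_right[symmetric] n_def using K Y_nonneg
    by (intro mult_right_mono sum_weight_balance_le finite_index) auto
  also have "(\<Sum>i\<in>I. \<Sum>A\<in>Pow (I - {i}). subset_weight n (card A) / balance n (card A) * b i) \<le> (\<Sum>i\<in>I. 2 * b i)"
    unfolding sum_distrib_right[symmetric] n_def
    by (intro sum_mono mult_right_mono sum_weight_divide_balance_le finite_index)
      (auto simp: b_def U_nonneg intro!: integral_nonneg)
  also have "\<dots> \<le> 2 * (Y / K)"
    using sum_b by (simp add: sum_distrib_left[symmetric])
  also have "c / 2 * (2 * (Y / K) + 2 * (Y / K)) = Y"
    using K by (simp add: K_def)
  finally have "(\<integral>x. U x ^ q \<partial>P) \<le> Y" using K by (simp add: c_def)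
  then have "real q * (\<integral>x. U x ^ q \<partial>P) \<le> K ^ q * (\<integral>x. V x ^ q \<partial>P) + real r * (\<integral>x. U x ^ q \<partial>P)"
    using q by (simp add: Y_def field_simps)
  then have "(\<integral>x. U x ^ q \<partial>P) \<le> K ^ q * (\<integral>x. V x ^ q \<partial>P)"
    by (simp add: r algebra_simps)
  also have "\<dots> \<le> (4 * real q) ^ q * (\<integral>x. V x ^ q \<partial>P)"
    using K V_nonneg by (intro mult_right_mono power_mono integral_nonneg) (auto simp: K_def c_def r)
  finally show ?thesis by (simp add: U_def g_def power_mult)
qed

end

subsection \<open>Operator norms of tensors\<close>

definition unit_vecs :: "nat \<Rightarrow> nat \<Rightarrow> (nat \<Rightarrow> nat \<Rightarrow> real) \<Rightarrow> bool" where
  "unit_vecs n k v \<longleftrightarrow> (\<forall>j<k. sqrt (\<Sum>i<n. (v j i)\<^sup>2) \<le> 1)"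

definition tform :: "nat \<Rightarrow> nat \<Rightarrow> (nat \<Rightarrow> nat \<Rightarrow> real) \<Rightarrow> (nat list \<Rightarrow> real) \<Rightarrow> real" where
  "tform n k v A = (\<Sum>is\<in>idx n k. (\<Prod>j<k. v j (is ! j)) * A is)"

lemma opnorm_eq_Sup: "opnorm n k A = Sup {tform n k v A | v. unit_vecs n k v}"
  by (simp add: opnorm_def tform_def unit_vecs_def)

lemma finite_idx: "finite (idx n k)"
  using finite_lists_length_eq[of "{..<n}" k] by (simp add: idx_def conj_commute)

lemma idx_Suc: "idx n (Suc k) = (\<lambda>(i, is). i # is) ` ({..<n} \<times> idx n k)"
  by (auto simp: idx_def length_Suc_conv image_iff)

lemma idx_0: "idx n 0 = {[]}"
  by (auto simp: idx_def)

lemma unit_vecs_abs: "unit_vecs n k v \<Longrightarrow> unit_vecs n k (\<lambda>j i. \<bar>v j i\<bar>)"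
  by (simp add: unit_vecs_def)

lemma unit_vecs_entry_le:
  assumes "unit_vecs n k v" "j < k" "i < n"
  shows "\<bar>v j i\<bar> \<le> 1"
proof -
  have "(v j i)\<^sup>2 \<le> (\<Sum>i<n. (v j i)\<^sup>2)"
    using assms(3) by (intro member_le_sum) auto
  then have "sqrt ((v j i)\<^sup>2) \<le> sqrt (\<Sum>i<n. (v j i)\<^sup>2)"
    by (rule real_sqrt_le_mono)
  also have "\<dots> \<le> 1" using assms by (simp add: unit_vecs_def)
  finally show ?thesis by simp
qed

lemma abs_tform_le:
  assumes "unit_vecs n k v"
  shows "\<bar>tform n k v A\<bar> \<le> (\<Sum>is\<in>idx n k. \<bar>A is\<bar>)"
  unfolding tform_def
proof (rule order_trans[OF sum_abs sum_mono])
  fix "is" assume "is": "is \<in> idx n k"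
  have "\<bar>\<Prod>j<k. v j (is ! j)\<bar> \<le> (\<Prod>j<k. 1)"
    unfolding abs_prod using "is"
    by (intro prod_mono) (auto intro!: unit_vecs_entry_le[OF assms] simp: idx_def subset_iff)
  then show "\<bar>(\<Prod>j<k. v j (is ! j)) * A is\<bar> \<le> \<bar>A is\<bar>"
    by (simp add: abs_mult mult_left_le_one_le)
qed

lemma tform_le_opnorm:
  assumes "unit_vecs n k v"
  shows "tform n k v A \<le> opnorm n k A"
  unfolding opnorm_eq_Sup
proof (rule cSup_upper)
  show "bdd_above {tform n k v A | v. unit_vecs n k v}"
    by (auto intro!: bdd_aboveI[of _ "\<Sum>is\<in>idx n k. \<bar>A is\<bar>"] abs_le_D1[OF abs_tform_le])
qed (use assms in auto)

lemma tform_diff: "tform n k v (\<lambda>is. A is - B is) = tform n k v A - tform n k v B"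
  by (simp add: tform_def right_diff_distrib sum_subtractf)

lemma unit_vecs_0: "unit_vecs n k (\<lambda>_ _. 0)"
  by (simp add: unit_vecs_def)

lemma opnorm_least:
  assumes "\<And>v. unit_vecs n k v \<Longrightarrow> tform n k v A \<le> c"
  shows "opnorm n k A \<le> c"
  unfolding opnorm_eq_Sup using unit_vecs_0[of n k] by (intro cSup_least) (auto intro: assms)

text \<open>For k = 0 the product is empty and the norm is the signed entry \<open>A []\<close>,
  hence the restriction on k.\<close>

lemma opnorm_nonneg: "0 < k \<Longrightarrow> 0 \<le> opnorm n k A"
  using tform_le_opnorm[OF unit_vecs_0, of n k A] by (simp add: tform_def power_0_left)

lemma opnorm_le_sum: "opnorm n k A \<le> (\<Sum>is\<in>idx n k. \<bar>A is\<bar>)"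
  by (rule opnorm_least) (rule abs_le_D1[OF abs_tform_le])

text \<open>Leads to continuity in the product topology, from which measurability of this supremum
  over uncountably many vectors is obtained.\<close>

lemma opnorm_lipschitz: "\<bar>opnorm n k A - opnorm n k B\<bar> \<le> (\<Sum>is\<in>idx n k. \<bar>A is - B is\<bar>)"
proof -
  have "opnorm n k A \<le> opnorm n k B + (\<Sum>is\<in>idx n k. \<bar>A is - B is\<bar>)" for A B
  proof (rule opnorm_least)
    fix v assume v: "unit_vecs n k v"
    show "tform n k v A \<le> opnorm n k B + (\<Sum>is\<in>idx n k. \<bar>A is - B is\<bar>)"
      using tform_le_opnorm[OF v, of B] abs_tform_le[OF v, of "\<lambda>is. A is - B is"]
      unfolding tform_diff by linarith
  qed
  from this[of A B] this[of B A] show ?thesis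
    unfolding abs_minus_commute[of "B _"] by linarith
qed

lemma continuous_on_opnorm: "continuous_on UNIV (opnorm n k)"
  unfolding continuous_on
proof
  fix A :: "nat list \<Rightarrow> real"
  have coord: "((\<lambda>B :: nat list \<Rightarrow> real. B is) \<longlongrightarrow> A is) (at A)" for "is"
    using continuous_on_product_coordinates[of "is"] by (auto simp: continuous_on)
  have "((\<lambda>B. \<Sum>is\<in>idx n k. \<bar>B is - A is\<bar>) \<longlongrightarrow> (\<Sum>is\<in>idx n k. \<bar>A is - A is\<bar>)) (at A)"
    by (intro tendsto_intros coord)
  then have "((\<lambda>B. \<Sum>is\<in>idx n k. \<bar>B is - A is\<bar>) \<longlongrightarrow> 0) (at A)"
    by simp
  then have "((\<lambda>B. opnorm n k B - opnorm n k A) \<longlongrightarrow> 0) (at A)"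
    by (rule Lim_null_comparison[OF always_eventually, rotated]) (simp add: opnorm_lipschitz)
  then show "(opnorm n k \<longlongrightarrow> opnorm n k A) (at A)"
    by (simp add: LIM_zero_iff)
qed

lemma borel_measurable_opnorm:
  assumes "\<And>is. (\<lambda>x. T x is) \<in> borel_measurable N"
  shows "(\<lambda>x. opnorm n k (T x)) \<in> borel_measurable N"
  using measurable_coordinatewise_then_product[of T N, OF assms]
    borel_measurable_continuous_onI[OF continuous_on_opnorm, of n k]
  by (rule measurable_compose)

text \<open>Normalized, \<open>u\<close> becomes an additional first unit vector in the form of
  order \<open>Suc k\<close>. The zero vector is treated apart, as it cannot be normalized.\<close>

lemma sum_tform_slice_le:
  assumes "unit_vecs n k v"
  shows "(\<Sum>i<n. u i * tform n k v (\<lambda>is. A (i # is))) \<le> sqrt (\<Sum>i<n. (u i)\<^sup>2) * opnorm n (Suc k) A"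
proof (cases "(\<Sum>i<n. (u i)\<^sup>2) = 0")
  case True
  then have "\<forall>i<n. u i = 0" by (simp add: sum_nonneg_eq_0_iff)
  then show ?thesis by simp
next
  case False
  define s where "s = sqrt (\<Sum>i<n. (u i)\<^sup>2)"
  have s2: "s\<^sup>2 = (\<Sum>i<n. (u i)\<^sup>2)" by (simp add: s_def sum_nonneg)
  have s: "0 < s" using False sum_nonneg[of "{..<n}" "\<lambda>i. (u i)\<^sup>2"] by (simp add: s_def less_le)
  define w where "w j = (if j = 0 then (\<lambda>i. u i / s) else v (j - 1))" for j
  have "(\<Sum>i<n. (u i / s)\<^sup>2) = 1"
    using s by (simp add: power_divide sum_divide_distrib[symmetric] s2[symmetric])
  then have w: "unit_vecs n (Suc k) w"
    using assms by (auto simp: unit_vecs_def w_def)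
  have prod_w: "(\<Prod>j<Suc k. w j ((i # is) ! j)) = u i / s * (\<Prod>j<k. v j (is ! j))" for i "is"
    by (subst prod.lessThan_Suc_shift) (simp add: w_def)
  have "tform n (Suc k) w A = (\<Sum>(i, is)\<in>{..<n} \<times> idx n k. (u i / s) * ((\<Prod>j<k. v j (is ! j)) * A (i # is)))"
    unfolding tform_def idx_Suc
    by (subst sum.reindex) (auto simp: inj_on_def prod_w simp del: prod.lessThan_Suc intro!: sum.cong)
  also have "\<dots> = (\<Sum>i<n. u i * tform n k v (\<lambda>is. A (i # is))) / s"
    by (simp add: sum.cartesian_product[symmetric] tform_def sum_distrib_left sum_divide_distrib)
  finally show ?thesis
    using tform_le_opnorm[OF w, of A] s by (simp add: s_def[symmetric] pos_divide_le_eq mult.commute)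
qed

text \<open>Testing against \<open>u i = max 0 (opnorm T - opnorm (T' i))\<close> replaces a maximizer of the form of \<open>T\<close>,
  which is common to all \<open>i\<close>; this is why only positive parts can be controlled.\<close>

lemma sum_pos_diff_opnorm_le:
  assumes T: "\<And>is. is \<in> idx n k \<Longrightarrow> 0 \<le> T is"
    and R: "\<And>i is. i < n \<Longrightarrow> is \<in> idx n k \<Longrightarrow> T is - T' i is \<le> R (i # is)"
  shows "(\<Sum>i<n. (max 0 (opnorm n k T - opnorm n k (T' i)))\<^sup>2) \<le> (opnorm n (Suc k) R)\<^sup>2"
proof -
  define u where "u i = max 0 (opnorm n k T - opnorm n k (T' i))" for i
  define s where "s = (\<Sum>i<n. u i)"
  define N where "N = sqrt (\<Sum>i<n. (u i)\<^sup>2)"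
  have u: "0 \<le> u i" for i by (simp add: u_def)
  have N: "0 \<le> N" "N\<^sup>2 = (\<Sum>i<n. (u i)\<^sup>2)" by (simp_all add: N_def sum_nonneg)
  have "s * tform n k v T \<le> N * opnorm n (Suc k) R + (\<Sum>i<n. u i * opnorm n k (T' i))" if v: "unit_vecs n k v" for v
  proof -
    \<comment> \<open>The entries of T are nonnegative, so absolute values only increase the form,
      and with nonnegative products the entrywise bound by R can be summed.\<close>
    define a where "a = (\<lambda>j i. \<bar>v j i\<bar>)"
    have a: "unit_vecs n k a" unfolding a_def by (rule unit_vecs_abs[OF v])
    have p: "0 \<le> (\<Prod>j<k. a j (is ! j))" for "is" by (simp add: a_def prod_nonneg)
    have "tform n k v T \<le> tform n k a T"
      unfolding tform_def a_def abs_prod[symmetric] by (intro sum_mono mult_right_mono T) auto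
    then have "s * tform n k v T \<le> (\<Sum>i<n. u i * tform n k a T)"
      unfolding s_def sum_distrib_right by (intro sum_mono mult_left_mono u)
    also have "\<dots> \<le> (\<Sum>i<n. u i * (tform n k a (\<lambda>is. R (i # is)) + opnorm n k (T' i)))"
    proof (intro sum_mono mult_left_mono u)
      fix i assume "i \<in> {..<n}"
      have "tform n k a T = tform n k a (\<lambda>is. T is - T' i is) + tform n k a (T' i)"
        by (simp add: tform_diff)
      also have "tform n k a (\<lambda>is. T is - T' i is) \<le> tform n k a (\<lambda>is. R (i # is))"
        unfolding tform_def using \<open>i \<in> {..<n}\<close> by (intro sum_mono mult_left_mono R p) auto
      also have "tform n k a (T' i) \<le> opnorm n k (T' i)" by (rule tform_le_opnorm[OF a])
      finally show "tform n k a T \<le> tform n k a (\<lambda>is. R (i # is)) + opnorm n k (T' i)" by simp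
    qed
    also have "\<dots> \<le> N * opnorm n (Suc k) R + (\<Sum>i<n. u i * opnorm n k (T' i))"
      using sum_tform_slice_le[OF a, of u R] by (simp add: N_def distrib_left sum.distrib)
    finally show ?thesis .
  qed
  note * = this
  \<comment> \<open>The right side does not depend on v, so the supremum over v may be taken;
    dividing by s needs s > 0.\<close>
  have "s * opnorm n k T \<le> N * opnorm n (Suc k) R + (\<Sum>i<n. u i * opnorm n k (T' i))"
  proof (cases "s = 0")
    case True
    then show ?thesis using *[OF unit_vecs_0] by simp
  next
    case False
    then have s: "0 < s" using sum_nonneg[of "{..<n}" u] u by (simp add: s_def less_le)
    have "opnorm n k T \<le> (N * opnorm n (Suc k) R + (\<Sum>i<n. u i * opnorm n k (T' i))) / s"
      using * s by (intro opnorm_least) (simp add: pos_le_divide_eq mult.commute)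
    then show ?thesis using s by (simp add: pos_le_divide_eq mult.commute)
  qed
  then have "(\<Sum>i<n. u i * (opnorm n k T - opnorm n k (T' i))) \<le> N * opnorm n (Suc k) R"
    by (simp add: s_def right_diff_distrib sum_subtractf sum_distrib_right)
  also have "(\<Sum>i<n. u i * (opnorm n k T - opnorm n k (T' i))) = N\<^sup>2"
    unfolding N by (intro sum.cong) (auto simp: u_def max_def power2_eq_square)
  finally have "N \<le> opnorm n (Suc k) R"
    using N(1) opnorm_nonneg[of "Suc k" n R] by (cases "N = 0") (auto simp: power2_eq_square)
  then have "N\<^sup>2 \<le> (opnorm n (Suc k) R)\<^sup>2" using N(1) by (intro power_mono)
  then show ?thesis by (simp add: N u_def)
qed

text \<open>The normalized vector \<open>u\<close> is its own test vector: this is the slice bound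
  at order 0.\<close>

lemma sum_power2_le_opnorm:
  assumes "\<And>i. i < n \<Longrightarrow> 0 \<le> u i" "\<And>i. i < n \<Longrightarrow> u i \<le> R [i]"
  shows "(\<Sum>i<n. (u i)\<^sup>2) \<le> (opnorm n 1 R)\<^sup>2"
proof -
  define N where "N = sqrt (\<Sum>i<n. (u i)\<^sup>2)"
  have N: "0 \<le> N" "N\<^sup>2 = (\<Sum>i<n. (u i)\<^sup>2)" by (simp_all add: N_def sum_nonneg)
  have "N\<^sup>2 = (\<Sum>i<n. u i * u i)" unfolding N(2) by (simp add: power2_eq_square)
  also have "\<dots> \<le> (\<Sum>i<n. u i * R [i])"
    using assms by (intro sum_mono mult_left_mono) auto
  also have "\<dots> \<le> N * opnorm n 1 R"
    using sum_tform_slice_le[OF unit_vecs_0, where n = n and k = 0 and u = u and A = R] by (simp add: tform_def idx_0 N_def)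
  finally have "N \<le> opnorm n 1 R"
    using N(1) opnorm_nonneg[of 1 n R] by (cases "N = 0") (auto simp: power2_eq_square)
  then show ?thesis unfolding N(2)[symmetric] using N(1) by (intro power_mono)
qed

subsection \<open>Tensors of higher order differences\<close>

text \<open>The measure of the exceptional set depends measurably on the parameter. This permits
  essential suprema at a moving base point and exchanges of nested almost everywhere
  quantifiers.\<close>

lemma (in sigma_finite_measure) pred_AE [measurable (raw)]:
  assumes Q: "Measurable.pred (N \<Otimes>\<^sub>M M) (\<lambda>z. Q (fst z) (snd z))"
  shows "Measurable.pred N (\<lambda>x. AE y in M. Q x y)"
proof -
  have "(AE y in M. Q x y) \<longleftrightarrow> emeasure M {y \<in> space M. \<not> Q x y} = 0" if "x \<in> space N" for x
  proof (rule AE_iff_measurable[OF _ refl])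
    have "Measurable.pred M (Q x)"
      using measurable_compose[OF measurable_Pair1'[OF that] Q] by (simp add: comp_def)
    then show "{y \<in> space M. \<not> Q x y} \<in> sets M" by measurable
  qed
  moreover have "Measurable.pred N (\<lambda>x. emeasure M {y \<in> space M. \<not> Q x y} = 0)"
  proof -
    have "{z \<in> space (N \<Otimes>\<^sub>M M). snd z \<in> {y \<in> space M. \<not> Q (fst z) y}} = {z \<in> space (N \<Otimes>\<^sub>M M). \<not> Q (fst z) (snd z)}"
      by (auto simp: space_pair_measure)
    also have "\<dots> \<in> sets (N \<Otimes>\<^sub>M M)" using Q by measurable
    finally have [measurable]: "(\<lambda>x. emeasure M {y \<in> space M. \<not> Q x y}) \<in> borel_measurable N"
      by (intro measurable_emeasure) auto
    show ?thesis by measurable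
  qed
  ultimately show ?thesis by (subst measurable_cong)
qed

lemma AE_space_mono:
  assumes "AE x in M. Q x" "\<And>x. x \<in> space M \<Longrightarrow> Q x \<Longrightarrow> R x"
  shows "AE x in M. R x"
  using assms(1) by (rule AE_mp) (auto intro: AE_I2 assms(2))

section \<open>Almost everywhere statements after redrawing coordinates\<close>

context finite_product_prob_space
begin

lemma AE_mix_iff:
  assumes "Measurable.pred P Q"
  shows "(AE z in P \<Otimes>\<^sub>M P. Q (mix A (fst z) (snd z))) \<longleftrightarrow> (AE x in P. Q x)"
  using AE_distr_iff[of "\<lambda>z. mix A (fst z) (snd z)" "P \<Otimes>\<^sub>M P" P Q] assms
  unfolding distr_mix pred_def by simp

text \<open>Freezes the values on A: they come from u for both copies, while w remains random.
  Mixing preserves each law, and Fubini puts the quantifier over u in front.\<close>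

lemma AE_resample_pair:
  assumes Q: "Measurable.pred (P \<Otimes>\<^sub>M P) (\<lambda>w. Q (fst w) (snd w))" and AE: "AE w in P \<Otimes>\<^sub>M P. Q (fst w) (snd w)"
  shows "AE u in P \<Otimes>\<^sub>M P. AE w in P \<Otimes>\<^sub>M P. Q (mix A (fst w) (fst u)) (mix A (snd w) (snd u))"
proof -
  interpret PP: pair_prob_space P P by (rule pair_prob_space_P)
  interpret P2: prob_space "P \<Otimes>\<^sub>M P" by (rule prob_space_pair)
  have Q' [measurable (raw)]: "Measurable.pred N (\<lambda>z. Q (g z) (h z))"
    if "g \<in> N \<rightarrow>\<^sub>M P" "h \<in> N \<rightarrow>\<^sub>M P" for g h and N :: "'z measure"
    using measurable_compose[OF measurable_Pair[OF that] Q] by simp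
  \<comment> \<open>The quantifiers are obtained in the order x, b, x', a and brought to b, a, x, x'
    by three exchanges.\<close>
  define S where "S x b x' a = Q (mix A x b) (mix A x' a)" for x b x' a
  have S [measurable (raw)]: "Measurable.pred N (\<lambda>z. S (x z) (b z) (x' z) (a z))"
    if [measurable]: "x \<in> N \<rightarrow>\<^sub>M P" "b \<in> N \<rightarrow>\<^sub>M P" "x' \<in> N \<rightarrow>\<^sub>M P" "a \<in> N \<rightarrow>\<^sub>M P"
    for x b x' a and N :: "'z measure"
    unfolding S_def by (intro Q') measurable
  have pair_AE: "AE x in P. AE y in P. R x y" if "AE z in P \<Otimes>\<^sub>M P. R (fst z) (snd z)" for R
    using PP.AE_pair[OF that] by simp
  have "AE x in P. AE x' in P. Q x x'"
    using AE by (rule pair_AE)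
  then have "AE z in P \<Otimes>\<^sub>M P. AE x' in P. Q (mix A (fst z) (snd z)) x'"
    by (rule AE_mix)
  then have "AE z in P \<Otimes>\<^sub>M P. AE z' in P \<Otimes>\<^sub>M P. S (fst z) (snd z) (fst z') (snd z')"
    unfolding S_def by eventually_elim (rule AE_mix)
  then have "AE z in P \<Otimes>\<^sub>M P. AE x' in P. AE a in P. S (fst z) (snd z) x' a"
    by eventually_elim (rule pair_AE)
  then have "AE x in P. AE b in P. AE x' in P. AE a in P. S x b x' a"
    by (rule pair_AE)
  then have "AE x in P. AE b in P. AE a in P. AE x' in P. S x b x' a"
  proof (rule AE_space_mono)
    fix x assume x [measurable]: "x \<in> space P" and "AE b in P. AE x' in P. AE a in P. S x b x' a"
    from this(2) show "AE b in P. AE a in P. AE x' in P. S x b x' a"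
    proof (rule AE_space_mono)
      fix b assume [measurable]: "b \<in> space P" and "AE x' in P. AE a in P. S x b x' a"
      then show "AE a in P. AE x' in P. S x b x' a"
        by (subst PP.AE_commute[symmetric]) measurable
    qed
  qed
  then have "AE b in P. AE x in P. AE a in P. AE x' in P. S x b x' a"
    by (subst PP.AE_commute[symmetric]) measurable
  then have "AE b in P. AE a in P. AE x in P. AE x' in P. S x b x' a"
  proof (rule AE_space_mono)
    fix b assume [measurable]: "b \<in> space P"
      and "AE x in P. AE a in P. AE x' in P. S x b x' a"
    then show "AE a in P. AE x in P. AE x' in P. S x b x' a"
      by (subst PP.AE_commute[symmetric]) measurable
  qed
  then have "AE u in P \<Otimes>\<^sub>M P. AE x in P. AE x' in P. S x (fst u) x' (snd u)"
    by (subst PP.AE_pair_iff[symmetric]) measurable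
  then show ?thesis
  proof (rule AE_space_mono)
    fix u assume u [measurable]: "u \<in> space (P \<Otimes>\<^sub>M P)" and *: "AE x in P. AE x' in P. S x (fst u) x' (snd u)"
    have [measurable]: "fst u \<in> space P" "snd u \<in> space P"
      using u by (auto simp: space_pair_measure)
    have "AE w in P \<Otimes>\<^sub>M P. S (fst w) (fst u) (snd w) (snd u)"
      using * by (subst PP.AE_pair_iff[symmetric]) measurable
    then show "AE w in P \<Otimes>\<^sub>M P. Q (mix A (fst w) (fst u)) (mix A (snd w) (snd u))"
      by (simp add: S_def)
  qed
qed
text \<open>Since \<open>mix {i} y b\<close> has the law of y, it suffices to redraw coordinate i of
  each fixed point. This serves bounds that do not see that coordinate of y.\<close>

lemma AE_transfer_resample:
  assumes Q [measurable]: "Measurable.pred (P \<Otimes>\<^sub>M P) Q"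
    and *: "\<And>y. y \<in> space P \<Longrightarrow> AE u in P \<Otimes>\<^sub>M P. Q (mix {i} y (fst u), snd u)"
  shows "AE z in P \<Otimes>\<^sub>M P. Q z"
proof -
  interpret PP: pair_prob_space P P by (rule pair_prob_space_P)
  have "AE y in P. AE b in P. AE a in P. Q (mix {i} y b, a)"
  proof (rule AE_I2)
    fix y assume "y \<in> space P"
    from PP.AE_pair[OF *[OF this]] show "AE b in P. AE a in P. Q (mix {i} y b, a)" by simp
  qed
  then have "AE z in P \<Otimes>\<^sub>M P. AE a in P. Q (mix {i} (fst z) (snd z), a)"
    by (subst PP.AE_pair_iff[symmetric]) measurable
  then have "AE y in P. AE a in P. Q (y, a)"
    by (subst (asm) AE_mix_iff[where Q = "\<lambda>y. AE a in P. Q (y, a)"]) measurable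
  then show ?thesis
    by (rule PP.AE_pair_measure[rotated]) measurable
qed

end

section \<open>Algebra of iterated differences\<close>

lemma subst_coords_eq_mix: "K \<subseteq> J \<Longrightarrow> subst_coords J K y x x' = mix K (mix J y x) x'"
  by (auto simp: subst_coords_def mix_def fun_eq_iff)

lemma diff_op_eq_mix: "diff_op J f y x x' = (\<Sum>K\<in>Pow J. (-1) ^ card K * f (mix K (mix J y x) x'))"
  unfolding diff_op_def by (intro sum.cong) (auto simp: subst_coords_eq_mix)

lemma diff_op_mix_base: "i \<in> J \<Longrightarrow> diff_op J f (mix {i} y a) x x' = diff_op J f y x x'"
  unfolding diff_op_eq_mix by (intro sum.cong refl arg_cong2[where f = times] arg_cong[where f = f]) (auto simp: mix_def fun_eq_iff)

lemma diff_op_mix_copies: "i \<notin> J \<Longrightarrow> diff_op J f y (mix {i} x b) (mix {i} x' a) = diff_op J f y x x'"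
  unfolding diff_op_eq_mix by (intro sum.cong refl arg_cong2[where f = times] arg_cong[where f = f]) (auto simp: mix_def fun_eq_iff)

text \<open>Splitting the subsets by whether they contain i shows a difference of the next order as
  the change of the current one when coordinate i of the base point moves, the copies on J being
  shared. Hence the next tensor controls the current one.\<close>

lemma diff_op_insert:
  assumes "finite J" "i \<notin> J"
  shows "diff_op (insert i J) f y x x' = diff_op J f (mix {i} y x) x x' - diff_op J f (mix {i} y x') x x'"
proof -
  have "diff_op (insert i J) f y x x' = (\<Sum>K\<in>Pow J. (-1) ^ card K * f (mix K (mix (insert i J) y x) x'))
      + (\<Sum>K\<in>insert i ` Pow J. (-1) ^ card K * f (mix K (mix (insert i J) y x) x'))"
    unfolding diff_op_eq_mix Pow_insert using assms by (intro sum.union_disjoint) auto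
  also have "(\<Sum>K\<in>insert i ` Pow J. (-1) ^ card K * f (mix K (mix (insert i J) y x) x'))
      = (\<Sum>K\<in>Pow J. (-1) ^ card (insert i K) * f (mix (insert i K) (mix (insert i J) y x) x'))"
    using assms by (intro sum.reindex_cong[OF _ refl]) (auto simp: inj_on_def)
  also have "\<dots> = - (\<Sum>K\<in>Pow J. (-1) ^ card K * f (mix K (mix J (mix {i} y x') x) x'))"
    unfolding sum_negf[symmetric]
  proof (rule sum.cong[OF refl])
    fix K assume K: "K \<in> Pow J"
    then have "mix (insert i K) (mix (insert i J) y x) x' = mix K (mix J (mix {i} y x') x) x'"
      using assms by (auto simp: mix_def fun_eq_iff)
    moreover have "card (insert i K) = Suc (card K)"
      using K assms finite_subset[of K J] by (intro card_insert_disjoint) auto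
    ultimately show "(-1) ^ card (insert i K) * f (mix (insert i K) (mix (insert i J) y x) x')
        = - ((-1) ^ card K * f (mix K (mix J (mix {i} y x') x) x'))" by simp
  qed
  also have "(\<Sum>K\<in>Pow J. (-1) ^ card K * f (mix K (mix (insert i J) y x) x'))
      = (\<Sum>K\<in>Pow J. (-1) ^ card K * f (mix K (mix J (mix {i} y x) x) x'))"
    by (intro sum.cong refl arg_cong2[where f = times] arg_cong[where f = f]) (auto simp: mix_def fun_eq_iff)
  finally show ?thesis by (simp add: diff_op_eq_mix)
qed

section \<open>Essential suprema of differences on the product of the laws\<close>

locale bounded_functional = finite_product_prob_space L "{..<n}" for L :: "nat \<Rightarrow> 'a measure" and n :: nat +
  fixes f :: "(nat \<Rightarrow> 'a) \<Rightarrow> real"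
  assumes f_bdd: "ess_bdd P f"
begin

lemma f_measurable [measurable]: "f \<in> borel_measurable P"
  using f_bdd by (rule ess_bdd_measurable)

text \<open>The supremum runs over pairs of full points: a difference reads the copies only on J,
  and one space \<open>P\<close> then serves every J.\<close>

definition hcoef_at :: "nat set \<Rightarrow> (nat \<Rightarrow> 'a) \<Rightarrow> ereal" where
  "hcoef_at J y = esssup (P \<Otimes>\<^sub>M P) (\<lambda>z. ereal \<bar>diff_op J f y (fst z) (snd z)\<bar>)"

definition htensor_at :: "(nat \<Rightarrow> 'a) \<Rightarrow> nat list \<Rightarrow> real" where
  "htensor_at y is = (if distinct is then real_of_ereal (hcoef_at (set is) y) else 0)"

lemma measurable_diff_op [measurable (raw)]:
  assumes [measurable]: "y \<in> N \<rightarrow>\<^sub>M P" "x \<in> N \<rightarrow>\<^sub>M P" "x' \<in> N \<rightarrow>\<^sub>M P"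
  shows "(\<lambda>z. diff_op J f (y z) (x z) (x' z)) \<in> borel_measurable N"
  unfolding diff_op_eq_mix by measurable

lemma AE_le_hcoef_at: "AE z in P \<Otimes>\<^sub>M P. ereal \<bar>diff_op J f y (fst z) (snd z)\<bar> \<le> hcoef_at J y"
  unfolding hcoef_at_def by (rule esssup_AE)

lemma hcoef_at_le_iff:
  assumes [measurable]: "y \<in> space P"
  shows "hcoef_at J y \<le> c \<longleftrightarrow> (AE z in P \<Otimes>\<^sub>M P. ereal \<bar>diff_op J f y (fst z) (snd z)\<bar> \<le> c)"
proof
  assume "hcoef_at J y \<le> c"
  with AE_le_hcoef_at[of J y] show "AE z in P \<Otimes>\<^sub>M P. ereal \<bar>diff_op J f y (fst z) (snd z)\<bar> \<le> c"
    by (auto elim: eventually_mono intro: order_trans)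
next
  have "(\<lambda>z. ereal \<bar>diff_op J f y (fst z) (snd z)\<bar>) \<in> borel_measurable (P \<Otimes>\<^sub>M P)" by measurable
  then show "AE z in P \<Otimes>\<^sub>M P. ereal \<bar>diff_op J f y (fst z) (snd z)\<bar> \<le> c \<Longrightarrow> hcoef_at J y \<le> c"
    unfolding hcoef_at_def by (rule esssup_I)
qed

lemma hcoef_at_nonneg: "0 \<le> hcoef_at J y"
proof -
  interpret P2: prob_space "P \<Otimes>\<^sub>M P" by (rule prob_space_pair)
  obtain z where "ereal \<bar>diff_op J f y (fst z) (snd z)\<bar> \<le> hcoef_at J y"
    using eventually_happens'[OF P2.ae_filter_bot AE_le_hcoef_at] by blast
  then show ?thesis by (rule order_trans[rotated]) simp
qed

text \<open>A sublevel set of an essential supremum is an almost everywhere condition on the copies,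
  which is measurable in y.\<close>

lemma borel_measurable_hcoef_at [measurable]: "hcoef_at J \<in> borel_measurable P"
proof (rule borel_measurableI_le)
  interpret P2: prob_space "P \<Otimes>\<^sub>M P" by (rule prob_space_pair)
  fix c
  have "{y \<in> space P. hcoef_at J y \<le> c} = {y \<in> space P. AE z in P \<Otimes>\<^sub>M P. ereal \<bar>diff_op J f y (fst z) (snd z)\<bar> \<le> c}"
    using hcoef_at_le_iff by auto
  also have "\<dots> \<in> sets P" by measurable
  finally show "{y \<in> space P. hcoef_at J y \<le> c} \<in> sets P" .
qed

text \<open>Each of the 2^|J| terms evaluates f at a mixture with law \<open>P\<close>. The bound is
  for almost every y only, since the coordinates of y outside J are not redrawn and may be
  exceptional.\<close>

lemma AE_hcoef_at_le:
  assumes J: "finite J" and B: "AE y in P. \<bar>f y\<bar> \<le> B"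
  shows "AE y in P. hcoef_at J y \<le> ereal (2 ^ card J * B)"
proof -
  interpret PP: pair_prob_space P P by (rule pair_prob_space_P)
  have "AE y in P. AE z in P \<Otimes>\<^sub>M P. \<bar>f (mix K (mix J y (fst z)) (snd z))\<bar> \<le> B" for K
  proof -
    have "AE y in P. AE x' in P. \<bar>f (mix K y x')\<bar> \<le> B"
      using PP.AE_pair[OF AE_mix[OF B, of K]] by simp
    from PP.AE_pair[OF AE_mix[OF this, of J]]
    have "AE y in P. AE x in P. AE x' in P. \<bar>f (mix K (mix J y x) x')\<bar> \<le> B" by simp
    then show ?thesis
    proof (rule AE_space_mono)
      fix y assume [measurable]: "y \<in> space P" and "AE x in P. AE x' in P. \<bar>f (mix K (mix J y x) x')\<bar> \<le> B"
      then show "AE z in P \<Otimes>\<^sub>M P. \<bar>f (mix K (mix J y (fst z)) (snd z))\<bar> \<le> B"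
        by (subst PP.AE_pair_iff[symmetric]) measurable
    qed
  qed
  then have "AE y in P. \<forall>K\<in>Pow J. AE z in P \<Otimes>\<^sub>M P. \<bar>f (mix K (mix J y (fst z)) (snd z))\<bar> \<le> B"
    using J by (intro AE_finite_allI) auto
  then show ?thesis
  proof (rule AE_space_mono)
    fix y assume y: "y \<in> space P"
      and "\<forall>K\<in>Pow J. AE z in P \<Otimes>\<^sub>M P. \<bar>f (mix K (mix J y (fst z)) (snd z))\<bar> \<le> B"
    then have "AE z in P \<Otimes>\<^sub>M P. \<forall>K\<in>Pow J. \<bar>f (mix K (mix J y (fst z)) (snd z))\<bar> \<le> B"
      using J by (intro AE_finite_allI) auto
    then have "AE z in P \<Otimes>\<^sub>M P. ereal \<bar>diff_op J f y (fst z) (snd z)\<bar> \<le> ereal (2 ^ card J * B)"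
    proof eventually_elim
      case (elim z)
      have "\<bar>diff_op J f y (fst z) (snd z)\<bar> \<le> (\<Sum>K\<in>Pow J. \<bar>f (mix K (mix J y (fst z)) (snd z))\<bar>)"
        unfolding diff_op_eq_mix by (rule order_trans[OF sum_abs]) (simp add: abs_mult power_abs)
      also have "\<dots> \<le> (\<Sum>K\<in>Pow J. B)" using elim by (intro sum_mono) auto
      finally show ?case using J by (simp add: card_Pow)
    qed
    then show "hcoef_at J y \<le> ereal (2 ^ card J * B)" using hcoef_at_le_iff[OF y] by blast
  qed
qed

lemma hcoef_at_mix_base: "i \<in> J \<Longrightarrow> hcoef_at J (mix {i} y a) = hcoef_at J y"
  by (simp add: hcoef_at_def diff_op_mix_base)

text \<open>In the difference over \<open>insert i J\<close>, u supplies coordinate i of the copies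
  and w the coordinates in J. With u frozen it compares two base points and is maximized over w
  alone.\<close>

lemma AE_diff_op_resample:
  assumes J: "finite J" "i \<notin> J" and y [measurable]: "y \<in> space P"
  shows "AE u in P \<Otimes>\<^sub>M P. AE w in P \<Otimes>\<^sub>M P.
    ereal \<bar>diff_op J f (mix {i} y (fst u)) (fst w) (snd w) - diff_op J f (mix {i} y (snd u)) (fst w) (snd w)\<bar> \<le> hcoef_at (insert i J) y"
proof -
  have "AE u in P \<Otimes>\<^sub>M P. AE w in P \<Otimes>\<^sub>M P.
      ereal \<bar>diff_op (insert i J) f y (mix {i} (fst w) (fst u)) (mix {i} (snd w) (snd u))\<bar> \<le> hcoef_at (insert i J) y"
    by (rule AE_resample_pair[where Q = "\<lambda>x x'. ereal \<bar>diff_op (insert i J) f y x x'\<bar> \<le> hcoef_at (insert i J) y"])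
      (measurable, rule AE_le_hcoef_at)
  moreover have "mix {i} y (mix {i} x b) = mix {i} y b" for x b :: "nat \<Rightarrow> 'a"
    by (auto simp: mix_def fun_eq_iff)
  ultimately show ?thesis
    using J by (simp add: diff_op_insert diff_op_mix_copies)
qed

text \<open>The triangle inequality is applied before the supremum over the copies is taken. The
  additive form avoids subtracting infinite values.\<close>

lemma AE_hcoef_at_diff_le:
  assumes J: "finite J" "i \<notin> J"
  shows "AE z in P \<Otimes>\<^sub>M P. hcoef_at J (fst z) \<le> hcoef_at (insert i J) (fst z) + hcoef_at J (mix {i} (fst z) (snd z))"
\<comment> \<open>Coordinate i of the base point may be redrawn because the coefficient of
  \<open>insert i J\<close> does not see it.\<close>
proof (rule AE_transfer_resample[where i = i])
  fix y assume y [measurable]: "y \<in> space P"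
  show "AE u in P \<Otimes>\<^sub>M P. hcoef_at J (fst (mix {i} y (fst u), snd u)) \<le> hcoef_at (insert i J) (fst (mix {i} y (fst u), snd u))
      + hcoef_at J (mix {i} (fst (mix {i} y (fst u), snd u)) (snd (mix {i} y (fst u), snd u)))"
    using AE_diff_op_resample[OF J y]
  proof (rule AE_space_mono)
    fix u assume u [measurable]: "u \<in> space (P \<Otimes>\<^sub>M P)" and *: "AE w in P \<Otimes>\<^sub>M P.
      ereal \<bar>diff_op J f (mix {i} y (fst u)) (fst w) (snd w) - diff_op J f (mix {i} y (snd u)) (fst w) (snd w)\<bar> \<le> hcoef_at (insert i J) y"
    have [measurable]: "fst u \<in> space P" using u by (auto simp: space_pair_measure)
    have space: "mix {i} y (fst u) \<in> space P"
      using measurable_space[OF measurable_mix[of "\<lambda>_. y" "P \<Otimes>\<^sub>M P" _ L "\<lambda>_. fst u"], OF _ _ u] by simp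
    have mix2: "mix {i} (mix {i} y (fst u)) (snd u) = mix {i} y (snd u)"
      by (auto simp: mix_def fun_eq_iff)
    have "AE w in P \<Otimes>\<^sub>M P. ereal \<bar>diff_op J f (mix {i} y (fst u)) (fst w) (snd w)\<bar> \<le> hcoef_at (insert i J) y + hcoef_at J (mix {i} y (snd u))"
      using * AE_le_hcoef_at[of J "mix {i} y (snd u)"]
    proof eventually_elim
      case (elim w)
      have "ereal \<bar>diff_op J f (mix {i} y (fst u)) (fst w) (snd w)\<bar>
        \<le> ereal \<bar>diff_op J f (mix {i} y (fst u)) (fst w) (snd w) - diff_op J f (mix {i} y (snd u)) (fst w) (snd w)\<bar>
          + ereal \<bar>diff_op J f (mix {i} y (snd u)) (fst w) (snd w)\<bar>" by simp
      also have "\<dots> \<le> hcoef_at (insert i J) y + hcoef_at J (mix {i} y (snd u))"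
        using elim by (rule add_mono)
      finally show ?case .
    qed
    then show "hcoef_at J (fst (mix {i} y (fst u), snd u)) \<le> hcoef_at (insert i J) (fst (mix {i} y (fst u), snd u))
      + hcoef_at J (mix {i} (fst (mix {i} y (fst u), snd u)) (snd (mix {i} y (fst u), snd u)))"
      using hcoef_at_le_iff[OF space] by (simp add: mix2 hcoef_at_mix_base)
  qed
qed measurable

text \<open>The case J = {}, where the difference operator returns f itself.\<close>

lemma AE_f_diff_le: "AE z in P \<Otimes>\<^sub>M P. ereal \<bar>f (fst z) - f (mix {i} (fst z) (snd z))\<bar> \<le> hcoef_at {i} (fst z)"
proof (rule AE_transfer_resample[where i = i])
  interpret P2: prob_space "P \<Otimes>\<^sub>M P" by (rule prob_space_pair)
  fix y assume y: "y \<in> space P"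
  have mix2: "mix {i} (mix {i} y x) x' = mix {i} y x'" for x x' :: "nat \<Rightarrow> 'a"
    by (auto simp: mix_def fun_eq_iff)
  show "AE u in P \<Otimes>\<^sub>M P. ereal \<bar>f (fst (mix {i} y (fst u), snd u)) - f (mix {i} (fst (mix {i} y (fst u), snd u)) (snd (mix {i} y (fst u), snd u)))\<bar>
      \<le> hcoef_at {i} (fst (mix {i} y (fst u), snd u))"
    using AE_diff_op_resample[of "{}" i, OF _ _ y] by (simp add: diff_op_eq_mix mix2 hcoef_at_mix_base)
qed measurable

lemma AE_hcoef_at_finite:
  assumes "finite J"
  shows "\<exists>B. AE y in P. hcoef_at J y \<le> ereal B"
  using f_bdd AE_hcoef_at_le[OF assms] unfolding ess_bdd_def by blast

lemma htensor_at_nonneg: "0 \<le> htensor_at y is"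
  by (simp add: htensor_at_def real_of_ereal_pos hcoef_at_nonneg)

lemma ess_bdd_htensor_at: "ess_bdd P (\<lambda>y. htensor_at y is)"
proof -
  obtain B where "AE y in P. hcoef_at (set is) y \<le> ereal B"
    using AE_hcoef_at_finite[of "set is"] by auto
  then have "AE y in P. \<bar>htensor_at y is\<bar> \<le> \<bar>B\<bar>"
  proof eventually_elim
    case (elim y)
    then show ?case
      using hcoef_at_nonneg[of "set is" y] by (cases "hcoef_at (set is) y") (auto simp: htensor_at_def)
  qed
  moreover have "(\<lambda>y. htensor_at y is) \<in> borel_measurable P"
    unfolding htensor_at_def by measurable
  ultimately show ?thesis by (intro ess_bddI)
qed

lemma ess_bdd_opnorm_htensor_at:
  assumes "0 < k"
  shows "ess_bdd P (\<lambda>y. opnorm n k (htensor_at y))"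
proof -
  have "ess_bdd P (\<lambda>y. \<Sum>is\<in>idx n k. htensor_at y is)"
    by (intro ess_bdd_intros ess_bdd_htensor_at)
  then obtain B where "AE y in P. \<bar>\<Sum>is\<in>idx n k. htensor_at y is\<bar> \<le> B" by (auto simp: ess_bdd_def)
  then have "AE y in P. \<bar>opnorm n k (htensor_at y)\<bar> \<le> B"
  proof eventually_elim
    case (elim y)
    then show ?case
      using opnorm_le_sum[of n k "htensor_at y"] opnorm_nonneg[OF assms, of n "htensor_at y"] by (simp add: htensor_at_nonneg)
  qed
  then show ?thesis
    using ess_bdd_measurable[OF ess_bdd_htensor_at] by (intro ess_bddI borel_measurable_opnorm)
qed

lemma AE_htensor_at_diff_le:
  "AE z in P \<Otimes>\<^sub>M P. htensor_at (fst z) is - htensor_at (mix {i} (fst z) (snd z)) is \<le> htensor_at (fst z) (i # is)"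
proof (cases "distinct is \<and> i \<notin> set is")
  case True
  \<comment> \<open>Finiteness matters: \<open>real_of_ereal\<close> sends infinity to 0, which
    could break the inequality.\<close>
  obtain B B' where "AE y in P. hcoef_at (set is) y \<le> ereal B" "AE y in P. hcoef_at (insert i (set is)) y \<le> ereal B'"
    using AE_hcoef_at_finite[of "set is"] AE_hcoef_at_finite[of "insert i (set is)"] by auto
  from this[THEN AE_mix]
  have "AE z in P \<Otimes>\<^sub>M P. hcoef_at (set is) (mix {} (fst z) (snd z)) \<le> ereal B"
    "AE z in P \<Otimes>\<^sub>M P. hcoef_at (set is) (mix {i} (fst z) (snd z)) \<le> ereal B"
    "AE z in P \<Otimes>\<^sub>M P. hcoef_at (insert i (set is)) (mix {} (fst z) (snd z)) \<le> ereal B'"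
    by blast+
  moreover have "AE z in P \<Otimes>\<^sub>M P. hcoef_at (set is) (fst z) \<le> hcoef_at (insert i (set is)) (fst z) + hcoef_at (set is) (mix {i} (fst z) (snd z))"
    using True by (intro AE_hcoef_at_diff_le) auto
  ultimately show ?thesis
  proof eventually_elim
    case (elim z)
    then show ?case
      using True hcoef_at_nonneg[of "set is" "fst z"] hcoef_at_nonneg[of "set is" "mix {i} (fst z) (snd z)"]
        hcoef_at_nonneg[of "insert i (set is)" "fst z"]
      by (cases "hcoef_at (set is) (fst z)"; cases "hcoef_at (set is) (mix {i} (fst z) (snd z))"; cases "hcoef_at (insert i (set is)) (fst z)")
        (auto simp: htensor_at_def)
  qed
next
  \<comment> \<open>With a repetition in \<open>is\<close> all three entries are 0; with i in
    \<open>is\<close>, resampling i changes nothing and the entry at \<open>i # is\<close> is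
    0.\<close>
  case False
  then show ?thesis by (auto simp: htensor_at_def hcoef_at_mix_base)
qed

lemma AE_sum_opnorm_htensor_at_diff_le:
  "AE z in P \<Otimes>\<^sub>M P. (\<Sum>i<n. (max 0 (opnorm n k (htensor_at (fst z)) - opnorm n k (htensor_at (mix {i} (fst z) (snd z)))))\<^sup>2)
    \<le> (opnorm n (Suc k) (htensor_at (fst z)))\<^sup>2"
proof -
  have "AE z in P \<Otimes>\<^sub>M P. \<forall>i\<in>{..<n}. \<forall>is\<in>idx n k. htensor_at (fst z) is - htensor_at (mix {i} (fst z) (snd z)) is \<le> htensor_at (fst z) (i # is)"
    by (intro AE_finite_allI finite_idx AE_htensor_at_diff_le) auto
  then show ?thesis
    by eventually_elim (rule sum_pos_diff_opnorm_le, auto simp: htensor_at_nonneg)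
qed

text \<open>The differences of f are bounded in absolute value, so -f is admissible too and yields
  the lower tail.\<close>

lemma AE_sum_f_diff_le:
  assumes "g = f \<or> g = (\<lambda>x. - f x)"
  shows "AE z in P \<Otimes>\<^sub>M P. (\<Sum>i<n. (max 0 (g (fst z) - g (mix {i} (fst z) (snd z))))\<^sup>2) \<le> (opnorm n 1 (htensor_at (fst z)))\<^sup>2"
proof -
  have "AE z in P \<Otimes>\<^sub>M P. \<bar>f (fst z) - f (mix {i} (fst z) (snd z))\<bar> \<le> htensor_at (fst z) [i]" for i
  proof -
    obtain B where "AE y in P. hcoef_at {i} y \<le> ereal B" using AE_hcoef_at_finite[of "{i}"] by auto
    from AE_mix[OF this, of "{}"] AE_f_diff_le[of i] show ?thesis
    proof eventually_elim
      case (elim z)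
      then show ?case
        using hcoef_at_nonneg[of "{i}" "fst z"] by (cases "hcoef_at {i} (fst z)") (auto simp: htensor_at_def)
    qed
  qed
  then have "AE z in P \<Otimes>\<^sub>M P. \<forall>i\<in>{..<n}. \<bar>f (fst z) - f (mix {i} (fst z) (snd z))\<bar> \<le> htensor_at (fst z) [i]"
    by (intro AE_finite_allI) auto
  then show ?thesis
  proof eventually_elim
    case (elim z)
    then show ?case
      using assms htensor_at_nonneg[of "fst z"] by (intro sum_power2_le_opnorm) (auto simp: abs_le_iff)
  qed
qed

end

subsection \<open>Tail bounds\<close>

lemma add_power_le:
  fixes a b :: real
  assumes "0 \<le> a" "0 \<le> b"
  shows "(a + b) ^ Suc m \<le> 2 ^ m * (a ^ Suc m + b ^ Suc m)"
proof (induction m)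
  case (Suc m)
  \<comment> \<open>The two factors have the same sign.\<close>
  have "0 \<le> (a - b) * (a ^ Suc m - b ^ Suc m)"
    using assms by (cases "a \<le> b") (auto simp del: power_Suc simp: power_mono intro: mult_nonpos_nonpos)
  then have "(a + b) * (a ^ Suc m + b ^ Suc m) \<le> 2 * (a ^ Suc (Suc m) + b ^ Suc (Suc m))"
    by (simp add: algebra_simps)
  then have "2 ^ m * ((a + b) * (a ^ Suc m + b ^ Suc m)) \<le> 2 ^ m * (2 * (a ^ Suc (Suc m) + b ^ Suc (Suc m)))"
    by (intro mult_left_mono) auto
  moreover have "(a + b) * (a + b) ^ Suc m \<le> (a + b) * (2 ^ m * (a ^ Suc m + b ^ Suc m))"
    using Suc assms by (intro mult_left_mono) auto
  ultimately have "(a + b) * (a + b) ^ Suc m \<le> 2 ^ m * (2 * (a ^ Suc (Suc m) + b ^ Suc (Suc m)))"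
    by (simp only: mult.left_commute)
  then show ?case by (simp only: power_Suc mult_ac)
qed simp

text \<open>The 16 is the 4 of the moment inequality times the square of the 2 in the norm
  bounds.\<close>

lemma moment_constant:
  fixes s r :: real
  shows "(4 * real q) ^ q * (2 * (s * r)) ^ (2 * q) = (16 * real q * r\<^sup>2) ^ q * s ^ (2 * q)"
proof -
  have "(4 * real q) ^ q * (2 * (s * r)) ^ (2 * q) = (4 * real q * (2 * (s * r))\<^sup>2) ^ q"
    by (simp only: power_mult power_mult_distrib)
  also have "4 * real q * (2 * (s * r))\<^sup>2 = 16 * real q * r\<^sup>2 * s\<^sup>2"
    by (simp add: power2_eq_square)
  finally show ?thesis by (simp only: power_mult power_mult_distrib)
qed

context bounded_functional
begin

text \<open>Downward induction from d. At level k the mean and the fluctuation are each at most t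
  r^k in L^(2q), so their sum is at most twice that and the factor 2 does not accumulate.\<close>

lemma opnorm_moment_bound:
  assumes q: "q \<ge> 1" and r: "0 \<le> r" "16 * real q * r\<^sup>2 \<le> 1" and t: "0 \<le> t"
    and mean: "\<And>k. 1 \<le> k \<Longrightarrow> k < d \<Longrightarrow> (\<integral>x. opnorm n k (htensor_at x) \<partial>P) \<le> t * r ^ k"
    and top: "AE x in P. opnorm n d (htensor_at x) \<le> t * r ^ d"
    and k: "1 \<le> k" "k \<le> d"
  shows "(\<integral>x. opnorm n k (htensor_at x) ^ (2 * q) \<partial>P) \<le> (2 * (t * r ^ k)) ^ (2 * q)"
  using k(2,1)
proof (induction k rule: inc_induct)
  case base
  have "(\<integral>x. opnorm n d (htensor_at x) ^ (2 * q) \<partial>P) \<le> (\<integral>x. (t * r ^ d) ^ (2 * q) \<partial>P)"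
  proof (rule integral_mono_AE)
    show "AE x in P. opnorm n d (htensor_at x) ^ (2 * q) \<le> (t * r ^ d) ^ (2 * q)"
      using top base opnorm_nonneg[of d n] by (auto elim!: eventually_mono intro!: power_mono)
  qed (use base in \<open>auto intro!: ess_bdd_integrable ess_bdd_intros ess_bdd_opnorm_htensor_at\<close>)
  \<comment> \<open>The factor 2 is inserted so that level d has the form of the induction
    hypothesis.\<close>
  also have "\<dots> \<le> (2 * (t * r ^ d)) ^ (2 * q)"
  proof -
    have "(t * r ^ d) ^ (2 * q) \<le> (2 * (t * r ^ d)) ^ (2 * q)"
      using r t by (intro power_mono) auto
    then show ?thesis by (simp add: P.prob_space)
  qed
  finally show ?case .
next
  case (step k)
  define W where "W x = opnorm n k (htensor_at x)" for x
  define a where "a = (\<integral>x. W x \<partial>P)"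
  define g where "g x = max 0 (W x - a)" for x
  define s where "s = t * r ^ k"
  have W: "ess_bdd P W" unfolding W_def[abs_def] using step by (intro ess_bdd_opnorm_htensor_at) auto
  have W_nonneg: "0 \<le> W x" for x using step by (simp add: W_def opnorm_nonneg)
  have g: "ess_bdd P g" unfolding g_def[abs_def] by (intro ess_bdd_intros W)
  have g_nonneg: "0 \<le> g x" for x by (simp add: g_def)
  have a: "0 \<le> a" "a \<le> s"
    using step mean[of k] W_nonneg unfolding a_def s_def W_def by (auto intro: integral_nonneg)
  have s: "0 \<le> s" using a by simp
  have "(\<integral>x. g x ^ (2 * q) \<partial>P) \<le> (4 * real q) ^ q * (\<integral>x. ((opnorm n (Suc k) (htensor_at x))\<^sup>2) ^ q \<partial>P)"
    unfolding g_def a_def using AE_sum_opnorm_htensor_at_diff_le[of k] W step(4)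
    by (intro moment_upper_tail q) (auto simp: W_def intro!: ess_bdd_intros ess_bdd_opnorm_htensor_at)
  also have "\<dots> \<le> (4 * real q) ^ q * (2 * (t * r ^ Suc k)) ^ (2 * q)"
    using step by (intro mult_left_mono) (auto simp: power_mult)
  also have "\<dots> = (16 * real q * r\<^sup>2) ^ q * s ^ (2 * q)"
    using moment_constant[of q s r] by (simp add: s_def mult_ac)
  also have "\<dots> \<le> s ^ (2 * q)"
    using r s by (intro mult_left_le_one_le power_le_one) auto
  finally have g_bound: "(\<integral>x. g x ^ (2 * q) \<partial>P) \<le> s ^ (2 * q)" .
  have "W x ^ (2 * q) \<le> 2 ^ (2 * q - 1) * (s ^ (2 * q) + g x ^ (2 * q))" for x
  proof -
    have "W x \<le> s + g x" using a by (simp add: g_def)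
    then have "W x ^ (2 * q) \<le> (s + g x) ^ (2 * q)" using W_nonneg by (intro power_mono)
    also have "\<dots> \<le> 2 ^ (2 * q - 1) * (s ^ (2 * q) + g x ^ (2 * q))"
      using add_power_le[of s "g x" "2 * q - 1"] s g_nonneg q by simp
    finally show ?thesis .
  qed
  then have "(\<integral>x. W x ^ (2 * q) \<partial>P) \<le> (\<integral>x. 2 ^ (2 * q - 1) * (s ^ (2 * q) + g x ^ (2 * q)) \<partial>P)"
    by (intro integral_mono ess_bdd_integrable ess_bdd_intros W g) auto
  also have "\<dots> = 2 ^ (2 * q - 1) * (s ^ (2 * q) + (\<integral>x. g x ^ (2 * q) \<partial>P))"
    by (subst integral_mult_right_zero, subst Bochner_Integration.integral_add)
      (auto intro!: ess_bdd_integrable ess_bdd_intros g simp: P.prob_space)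
  also have "\<dots> \<le> 2 ^ (2 * q - 1) * (s ^ (2 * q) + s ^ (2 * q))"
    using g_bound by (intro mult_left_mono add_left_mono) auto
  also have "\<dots> = (2 * s) ^ (2 * q)"
    using q by (cases q) (auto simp: power_mult_distrib)
  finally show ?case by (simp add: W_def s_def)
qed

text \<open>The 32 in place of 16 leaves a factor 1/2 in each of the q powers, which is the source
  of the exponential decay.\<close>

lemma upper_tail_bound:
  assumes g: "g = f \<or> g = (\<lambda>x. - f x)"
    and q: "q \<ge> 1" and r: "0 \<le> r" "32 * real q * r\<^sup>2 \<le> 1" and t: "0 < t" and d: "1 \<le> d"
    and mean: "\<And>k. 1 \<le> k \<Longrightarrow> k < d \<Longrightarrow> (\<integral>x. opnorm n k (htensor_at x) \<partial>P) \<le> t * r ^ k"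
    and top: "AE x in P. opnorm n d (htensor_at x) \<le> t * r ^ d"
  shows "measure P {x \<in> space P. t \<le> g x - (\<integral>y. g y \<partial>P)} \<le> (1 / 2) ^ q"
proof -
  define h where "h x = max 0 (g x - (\<integral>y. g y \<partial>P))" for x
  have g_bdd: "ess_bdd P g" using g f_bdd by (auto intro: ess_bdd_intros)
  have h: "ess_bdd P h" unfolding h_def[abs_def] by (intro ess_bdd_intros g_bdd)
  have "(\<integral>x. h x ^ (2 * q) \<partial>P) \<le> (4 * real q) ^ q * (\<integral>x. ((opnorm n 1 (htensor_at x))\<^sup>2) ^ q \<partial>P)"
    unfolding h_def using AE_sum_f_diff_le[OF g]
    by (intro moment_upper_tail q g_bdd) (auto intro!: ess_bdd_intros ess_bdd_opnorm_htensor_at)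
  also have "\<dots> \<le> (4 * real q) ^ q * (2 * (t * r ^ 1)) ^ (2 * q)"
    using opnorm_moment_bound[OF q r(1) _ _ mean top, of 1] r d t by (intro mult_left_mono) (auto simp: power_mult)
  also have "\<dots> = (16 * real q * r\<^sup>2) ^ q * t ^ (2 * q)"
    using moment_constant[of q t r] by simp
  also have "\<dots> \<le> (1 / 2) ^ q * t ^ (2 * q)"
    using r t by (intro mult_right_mono power_mono) auto
  finally have moment: "(\<integral>x. h x ^ (2 * q) \<partial>P) \<le> (1 / 2) ^ q * t ^ (2 * q)" .
  have "measure P {x \<in> space P. t \<le> g x - (\<integral>y. g y \<partial>P)} \<le> measure P {x \<in> space P. t ^ (2 * q) \<le> h x ^ (2 * q)}"
  proof (rule P.finite_measure_mono)
    have [measurable]: "h \<in> borel_measurable P" using h by (rule ess_bdd_measurable)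
    show "{x \<in> space P. t ^ (2 * q) \<le> h x ^ (2 * q)} \<in> sets P" by measurable
  qed (use t in \<open>auto simp: h_def intro!: power_mono\<close>)
  also have "\<dots> \<le> (\<integral>x. h x ^ (2 * q) \<partial>P) / t ^ (2 * q)"
    using t h by (intro integral_Markov_inequality_measure[of _ _ "{}"]) (auto intro!: ess_bdd_integrable ess_bdd_intros)
  also have "\<dots> \<le> (1 / 2) ^ q"
    using moment t by (simp add: pos_divide_le_eq)
  finally show ?thesis .
qed

end

section \<open>Rate terms and transfer to the random vector\<close>

lemma esssup_distr:
  assumes [measurable]: "T \<in> M \<rightarrow>\<^sub>M N" "g \<in> borel_measurable N"
  shows "esssup (distr M N T) g = esssup M (\<lambda>x. g (T x) :: ereal)"
proof -
  have "(AE x in distr M N T. g x \<le> z) \<longleftrightarrow> (AE x in M. g (T x) \<le> z)" for z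
    by (rule AE_distr_iff) measurable
  then show ?thesis
    by (simp add: esssup_eq_AE)
qed

lemma opnorm_cong:
  assumes "\<And>is. is \<in> idx n k \<Longrightarrow> A is = B is"
  shows "opnorm n k A = opnorm n k B"
proof -
  have "tform n k v A = tform n k v B" for v
    unfolding tform_def using assms by (intro sum.cong) auto
  then show ?thesis by (simp add: opnorm_eq_Sup)
qed

text \<open>Solves N <= (t / b)^(2/k) for b, which gives the scale t r^k with r = 1 / sqrt
  N.\<close>

lemma rterm_ge_imp_le:
  assumes N: "0 < N" and t: "0 < t" and k: "1 \<le> k" and le: "ereal N \<le> rterm t a k"
  shows "a \<le> ereal (t * (1 / sqrt N) ^ k)"
proof (cases a)
  case (real b)
  show ?thesis
  proof (cases "b \<le> 0")
    case True
    then show ?thesis using real t N by (auto intro: order_trans)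
  next
    case False
    then have b: "0 < b" by simp
    have "N \<le> (t / b) powr (2 / real k)"
      using le real b t by (simp add: rterm_def)
    then have "N powr (real k / 2) \<le> ((t / b) powr (2 / real k)) powr (real k / 2)"
      using N by (intro powr_mono2) auto
    also have "\<dots> = t / b"
      using t b k by (simp add: powr_powr)
    also have "N powr (real k / 2) = sqrt N ^ k"
      using N by (simp add: powr_half_sqrt[symmetric] powr_powr powr_realpow[symmetric])
    finally have "b * sqrt N ^ k \<le> t"
      using b by (simp add: pos_le_divide_eq mult.commute)
    then have "b \<le> t / sqrt N ^ k"
      using N by (simp add: pos_le_divide_eq)
    then show ?thesis using real by (simp add: power_one_over)
  qed
next
  \<comment> \<open>Here \<open>rterm\<close> is 0, because \<open>real_of_ereal\<close> of infinity
    and division by 0 both give 0; this contradicts 0 < N.\<close>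
  case PInf
  then show ?thesis using le N by (simp add: rterm_def)
qed simp

context bounded_functional
begin

lemma two_sided_tail_bound:
  assumes q: "q \<ge> 1" and t: "0 < t" and d: "1 \<le> d"
    and mean: "\<And>k. 1 \<le> k \<Longrightarrow> k < d \<Longrightarrow> (\<integral>x. opnorm n k (htensor_at x) \<partial>P) \<le> t * (1 / sqrt (32 * real q)) ^ k"
    and top: "AE x in P. opnorm n d (htensor_at x) \<le> t * (1 / sqrt (32 * real q)) ^ d"
  shows "measure P {x \<in> space P. t \<le> \<bar>f x - (\<integral>y. f y \<partial>P)\<bar>} \<le> 2 * (1 / 2) ^ q"
proof -
  have r: "0 \<le> 1 / sqrt (32 * real q)" "32 * real q * (1 / sqrt (32 * real q))\<^sup>2 \<le> 1"
    using q by (auto simp: power_divide)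
  have "measure P {x \<in> space P. t \<le> \<bar>f x - (\<integral>y. f y \<partial>P)\<bar>}
      \<le> measure P ({x \<in> space P. t \<le> f x - (\<integral>y. f y \<partial>P)} \<union> {x \<in> space P. t \<le> - f x - (\<integral>y. - f y \<partial>P)})"
    by (intro P.finite_measure_mono) (auto simp: abs_if split: if_splits)
  also have "\<dots> \<le> measure P {x \<in> space P. t \<le> f x - (\<integral>y. f y \<partial>P)} + measure P {x \<in> space P. t \<le> - f x - (\<integral>y. - f y \<partial>P)}"
    by (intro measure_Un_le) measurable
  also have "\<dots> \<le> (1 / 2) ^ q + (1 / 2) ^ q"
    by (intro add_mono upper_tail_bound[OF _ q r t d mean top]) auto
  finally show ?thesis by simp
qed

text \<open>Restriction to J maps \<open>P\<close> to the product over J, and the difference reads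
  nothing else of the copies.\<close>

lemma hcoef_eq_hcoef_at:
  assumes L: "\<And>i. i < n \<Longrightarrow> law N S X i = L i" and J: "J \<subseteq> {..<n}" and y: "y \<in> space P"
  shows "hcoef N S X f J y = hcoef_at J y"
proof -
  define \<rho> where "\<rho> z = (restrict (fst z) J, restrict (snd z) J)" for z :: "(nat \<Rightarrow> 'a) \<times> (nat \<Rightarrow> 'a)"
  define F where "F z = ereal \<bar>diff_op J f y (fst z) (snd z)\<bar>" for z
  define Q where "Q = PiM J L \<Otimes>\<^sub>M PiM J L"
  have restrict_meas: "(\<lambda>x. restrict x J) \<in> P \<rightarrow>\<^sub>M PiM J L"
    using J by (intro measurable_restrict_subset)
  then have \<rho> [measurable]: "\<rho> \<in> P \<Otimes>\<^sub>M P \<rightarrow>\<^sub>M Q"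
    unfolding \<rho>_def Q_def by measurable
  have "PiM J L = distr P (PiM J L) (\<lambda>x. restrict x J)"
    using J by (intro distr_restrict) auto
  moreover have "prob_space (PiM J L)" by (intro prob_space_PiM prob_space)
  ultimately have "Q = distr (P \<Otimes>\<^sub>M P) Q \<rho>"
    using pair_measure_distr[OF restrict_meas restrict_meas]
    by (simp add: Q_def \<rho>_def[abs_def] split_beta' prob_space_imp_sigma_finite)
  have sub_meas: "(\<lambda>z. subst_coords J K y (fst z) (snd z)) \<in> Q \<rightarrow>\<^sub>M P" if "K \<subseteq> J" for K
  proof (rule measurable_PiM_single')
    show "(\<lambda>z. subst_coords J K y (fst z) (snd z)) \<in> space Q \<rightarrow> (\<Pi>\<^sub>E i\<in>{..<n}. space (L i))"
    proof (intro funcsetI PiE_I)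
      fix z i assume "z \<in> space Q" "i \<in> {..<n}"
      then show "subst_coords J K y (fst z) (snd z) i \<in> space (L i)"
        using y that by (auto simp: Q_def space_pair_measure space_PiM PiE_iff subst_coords_def)
    next
      fix z i assume "i \<notin> {..<n}"
      then have "i \<notin> J" "i \<notin> K" "y i = undefined"
        using y J that by (auto simp: space_PiM PiE_iff extensional_def)
      then show "subst_coords J K y (fst z) (snd z) i = undefined"
        by (simp add: subst_coords_def)
    qed
    fix i assume i: "i \<in> {..<n}"
    have [measurable]: "y i \<in> space (L i)" using y i by (auto simp: space_PiM)
    have "(\<lambda>x. x i) \<in> PiM J L \<rightarrow>\<^sub>M L i" if "i \<in> J"
      using that by (rule measurable_component_singleton)
    then show "(\<lambda>z. subst_coords J K y (fst z) (snd z) i) \<in> Q \<rightarrow>\<^sub>M L i"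
      using that unfolding subst_coords_def Q_def
      by (cases "i \<in> J"; cases "i \<in> K") (auto intro: measurable_compose[OF measurable_fst] measurable_compose[OF measurable_snd])
  qed
  have F [measurable]: "F \<in> borel_measurable Q"
    unfolding F_def[abs_def] diff_op_def
    using measurable_compose[OF sub_meas f_measurable] by measurable
  have "PiM J (law N S X) = PiM J L" using J L by (intro PiM_cong) auto
  then have "hcoef N S X f J y = esssup Q F"
    by (simp add: hcoef_def Q_def F_def[abs_def] split_beta')
  also have "\<dots> = esssup (P \<Otimes>\<^sub>M P) (\<lambda>z. F (\<rho> z))"
    by (subst \<open>Q = distr (P \<Otimes>\<^sub>M P) Q \<rho>\<close>) (rule esssup_distr; measurable)
  also have "(\<lambda>z. F (\<rho> z)) = (\<lambda>z. ereal \<bar>diff_op J f y (fst z) (snd z)\<bar>)"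
  proof
    fix z
    have "subst_coords J K y (restrict (fst z) J) (restrict (snd z) J) = subst_coords J K y (fst z) (snd z)" if "K \<subseteq> J" for K
      using that by (auto simp: subst_coords_def fun_eq_iff)
    then have "diff_op J f y (restrict (fst z) J) (restrict (snd z) J) = diff_op J f y (fst z) (snd z)"
      unfolding diff_op_def by (intro sum.cong) auto
    then show "F (\<rho> z) = ereal \<bar>diff_op J f y (fst z) (snd z)\<bar>"
      by (simp add: F_def \<rho>_def)
  qed
  finally show ?thesis by (simp add: hcoef_at_def)
qed

end

lemma (in prob_space) distr_Xvec:
  assumes X: "indep_vars S X {..<n}"
  shows "distr M (PiM {..<n} S) (Xvec n X) = PiM {..<n} (law M S X)"
proof (cases "n = 0")
  case False
  have "\<And>i. i \<in> {..<n} \<Longrightarrow> random_variable (S i) (X i)"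
    using X by (auto simp: indep_vars_def)
  then show ?thesis
    using indep_vars_iff_distr_eq_PiM'[of "{..<n}" X S] X False
    unfolding Xvec_def[abs_def] law_def[abs_def] by auto
next
  \<comment> \<open>Both laws are the point mass at the everywhere undefined function.\<close>
  case True
  show ?thesis
  proof (rule measure_eqI)
    have meas: "Xvec 0 X \<in> M \<rightarrow>\<^sub>M PiM {} S"
      using measurable_restrict[of "{..<0}" X M S] by (simp add: Xvec_def[abs_def])
    show "sets (distr M (PiM {..<n} S) (Xvec n X)) = sets (PiM {..<n} (law M S X))"
      by (simp add: True PiM_empty)
    fix A assume "A \<in> sets (distr M (PiM {..<n} S) (Xvec n X))"
    then have "A = {} \<or> A = {\<lambda>_. undefined}" by (auto simp: True PiM_empty)
    then show "emeasure (distr M (PiM {..<n} S) (Xvec n X)) A = emeasure (PiM {..<n} (law M S X)) A"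
      using meas by (auto simp: True emeasure_distr PiM_empty Xvec_def vimage_def emeasure_space_1 restrict_def)
  qed
qed

text \<open>Since ln 2 >= 2/3, q >= m / 64 yields at least m / 96 in the exponent, which exceeds m /
  217.\<close>

lemma exp_bound_of_dyadic:
  assumes C: "217 \<le> C" and m: "32 \<le> m" and q: "m / 64 \<le> real q"
  shows "(1 / 2) ^ q \<le> exp (- m / C)"
proof -
  have "m / C \<le> m / 217" using C m by (intro divide_left_mono) auto
  also have "\<dots> \<le> m / 64 * (2 / 3)" using m by simp
  also have "\<dots> \<le> real q * ln 2"
    using q m ln2_ge_two_thirds by (intro mult_mono) auto
  finally have "exp (- (real q * ln 2)) \<le> exp (- m / C)" by simp
  also have "exp (- (real q * ln 2)) = (1 / 2) ^ q"
    by (simp add: exp_minus exp_of_nat_mult power_one_over inverse_eq_divide)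
  finally show ?thesis .
qed

theorem theorem1p1:
  fixes M :: "'w measure" and S :: "nat \<Rightarrow> 'a measure" and X :: "nat \<Rightarrow> 'w \<Rightarrow> 'a"
    and n d :: nat and f :: "(nat \<Rightarrow> 'a) \<Rightarrow> real" and t :: real
  assumes "prob_space M"
    and "prob_space.indep_vars M S X {..<n}"
    and "f \<in> borel_measurable (PiM {..<n} S)"
    and "\<exists>B. AE \<omega> in M. \<bar>f (Xvec n X \<omega>)\<bar> \<le> B"
    and "d \<ge> 1"
    and "t \<ge> 0"
  shows "let C = 217 * (real d)\<^sup>2;
             m = Min ((\<lambda>k. rterm t (opnorm1 M n k (htensor M S X n f)) k) ` {1..<d}
                      \<union> {rterm t (opnorminf M n d (htensor M S X n f)) d})
         in measure M {\<omega> \<in> space M. \<bar>f (Xvec n X \<omega>) - (\<integral>\<omega>'. f (Xvec n X \<omega>') \<partial>M)\<bar> \<ge> t}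
            \<le> (if m = \<infinity> then 0 else 2 * exp (- real_of_ereal m / C))"
proof -
  interpret M: prob_space M by fact
  \<comment> \<open>Beyond n a point mass is filled in: the product structure asks for a probability
    space at every index, and \<open>X i\<close> is unconstrained there.\<close>
  define L where "L i = (if i < n then law M S X i else return (count_space UNIV) undefined)" for i
  have rv: "X i \<in> M \<rightarrow>\<^sub>M S i" if "i < n" for i
    using assms(2) that by (auto simp: M.indep_vars_def)
  have "prob_space (L i)" for i
    using rv by (auto simp: L_def law_def intro!: M.prob_space_distr prob_space_return)
  then have "product_prob_space L" by (rule product_prob_spaceI)
  then interpret L: finite_product_prob_space L "{..<n}"
    by (simp add: finite_product_prob_space_def finite_product_sigma_finite_def
        finite_product_sigma_finite_axioms_def product_prob_space.axioms(1))
  have sets_P: "sets L.P = sets (PiM {..<n} S)"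
    by (intro sets_PiM_cong) (auto simp: L_def law_def)
  have Xvec_meas [measurable]: "Xvec n X \<in> M \<rightarrow>\<^sub>M L.P"
    unfolding measurable_cong_sets[OF refl sets_P] Xvec_def[abs_def]
    using rv by (intro measurable_restrict) auto
  have "PiM {..<n} (law M S X) = L.P"
    by (intro PiM_cong) (auto simp: L_def)
  then have distr_P: "distr M L.P (Xvec n X) = L.P"
    using M.distr_Xvec[OF assms(2)] distr_cong[OF refl sets_P] by metis
  have f_meas [measurable]: "f \<in> borel_measurable L.P"
    using assms(3) by (simp add: measurable_cong_sets[OF sets_P refl])
  obtain B where "AE \<omega> in M. \<bar>f (Xvec n X \<omega>)\<bar> \<le> B" using assms(4) by auto
  then have "AE x in distr M L.P (Xvec n X). \<bar>f x\<bar> \<le> B"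
    by (subst AE_distr_iff) measurable
  then have "AE x in L.P. \<bar>f x\<bar> \<le> B" by (simp only: distr_P)
  then interpret B: bounded_functional L n f
    by unfold_locales (auto intro: ess_bddI)

  define W where "W k x = opnorm n k (B.htensor_at x)" for k x
  have W_meas [measurable]: "W k \<in> borel_measurable L.P" for k
    unfolding W_def by (intro borel_measurable_opnorm ess_bdd_measurable B.ess_bdd_htensor_at)
  have htensor: "opnorm n k (htensor M S X n f \<omega>) = W k (Xvec n X \<omega>)" if "\<omega> \<in> space M" for k \<omega>
    unfolding W_def
  proof (rule opnorm_cong)
    fix "is" assume "is \<in> idx n k"
    then have "hcoef M S X f (set is) (Xvec n X \<omega>) = B.hcoef_at (set is) (Xvec n X \<omega>)"
      using that by (intro B.hcoef_eq_hcoef_at measurable_space[OF Xvec_meas]) (auto simp: L_def idx_def)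
    then show "htensor M S X n f \<omega> is = B.htensor_at (Xvec n X \<omega>) is"
      by (simp add: htensor_def B.htensor_at_def)
  qed
  \<comment> \<open>For k >= 1 the norm is nonnegative, so \<open>ennreal\<close> truncates
    nothing.\<close>
  have norm1: "opnorm1 M n k (htensor M S X n f) = ereal (\<integral>x. W k x \<partial>L.P)" if "1 \<le> k" for k
  proof -
    have W: "integrable L.P (W k)" "\<And>x. 0 \<le> W k x"
      using that unfolding W_def[abs_def]
      by (intro L.P.ess_bdd_integrable B.ess_bdd_opnorm_htensor_at opnorm_nonneg; simp)+
    have "(\<integral>\<^sup>+ \<omega>. ennreal (opnorm n k (htensor M S X n f \<omega>)) \<partial>M) = (\<integral>\<^sup>+ \<omega>. ennreal (W k (Xvec n X \<omega>)) \<partial>M)"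
      by (intro nn_integral_cong) (simp add: htensor)
    also have "\<dots> = (\<integral>\<^sup>+ x. ennreal (W k x) \<partial>L.P)"
      by (subst distr_P[symmetric], subst nn_integral_distr) measurable
    also have "\<dots> = ennreal (\<integral>x. W k x \<partial>L.P)"
      using W by (intro nn_integral_eq_integral) auto
    finally show ?thesis
      using W by (simp add: opnorm1_def enn2ereal_ennreal integral_nonneg)
  qed
  have norminf: "AE x in L.P. ereal (W d x) \<le> opnorminf M n d (htensor M S X n f)"
  proof -
    have "opnorminf M n d (htensor M S X n f) = esssup M (\<lambda>\<omega>. ereal (W d (Xvec n X \<omega>)))"
      unfolding opnorminf_def
    proof (rule esssup_AE_cong)
      show "(\<lambda>\<omega>. ereal (opnorm n d (htensor M S X n f \<omega>))) \<in> borel_measurable M"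
        by (subst measurable_cong[OF arg_cong[where f = ereal, OF htensor]]) measurable
    qed (auto simp: htensor)
    also have "\<dots> = esssup (distr M L.P (Xvec n X)) (\<lambda>x. ereal (W d x))"
      by (subst esssup_distr) measurable
    finally show ?thesis
      using esssup_AE[of "\<lambda>x. ereal (W d x)" L.P] by (simp only: distr_P)
  qed

  define p where "p = measure M {\<omega> \<in> space M. \<bar>f (Xvec n X \<omega>) - (\<integral>\<omega>'. f (Xvec n X \<omega>') \<partial>M)\<bar> \<ge> t}"
  have p_le_1: "p \<le> 1" unfolding p_def by (rule M.prob_le_1)
  have p_eq: "p = measure L.P {x \<in> space L.P. t \<le> \<bar>f x - (\<integral>y. f y \<partial>L.P)\<bar>}"
  proof -
    have "(\<integral>\<omega>'. f (Xvec n X \<omega>') \<partial>M) = (\<integral>y. f y \<partial>L.P)"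
      by (subst distr_P[symmetric], subst integral_distr) measurable
    moreover have "measure L.P {x \<in> space L.P. t \<le> \<bar>f x - (\<integral>y. f y \<partial>L.P)\<bar>}
        = measure (distr M L.P (Xvec n X)) {x \<in> space L.P. t \<le> \<bar>f x - (\<integral>y. f y \<partial>L.P)\<bar>}"
      by (simp only: distr_P)
    moreover have "\<dots> = measure M (Xvec n X -` {x \<in> space L.P. t \<le> \<bar>f x - (\<integral>y. f y \<partial>L.P)\<bar>} \<inter> space M)"
      by (rule measure_distr) measurable
    moreover have "Xvec n X -` {x \<in> space L.P. t \<le> \<bar>f x - c\<bar>} \<inter> space M = {\<omega> \<in> space M. t \<le> \<bar>f (Xvec n X \<omega>) - c\<bar>}" for c
      using measurable_space[OF Xvec_meas] by auto
    ultimately show ?thesis by (simp add: p_def)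
  qed

  define m where "m = Min ((\<lambda>k. rterm t (opnorm1 M n k (htensor M S X n f)) k) ` {1..<d}
                      \<union> {rterm t (opnorminf M n d (htensor M S X n f)) d})"
  have m_le: "m \<le> rterm t (opnorm1 M n k (htensor M S X n f)) k" if "1 \<le> k" "k < d" for k
    unfolding m_def using that by (intro Min_le) auto
  have m_le_d: "m \<le> rterm t (opnorminf M n d (htensor M S X n f)) d"
    unfolding m_def by (intro Min_le) auto
  \<comment> \<open>At t = 0 the last term of the minimum is 0, hence m <= 0.\<close>
  have t_pos: "0 < t" if "0 < m"
    using that m_le_d assms(6) by (cases "t = 0") (auto simp: rterm_def zero_ereal_def[symmetric])
  \<comment> \<open>Inverting the rate terms at N = 32 q gives exactly the scale r = 1 / sqrt (32
    q).\<close>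
  have tail: "p \<le> 2 * (1 / 2) ^ q" if q: "1 \<le> q" "ereal (32 * real q) \<le> m" for q
  proof -
    have "0 < ereal (32 * real q)" using q by simp
    then have t: "0 < t" using q(2) by (intro t_pos) (rule less_le_trans)
    have "(\<integral>x. W k x \<partial>L.P) \<le> t * (1 / sqrt (32 * real q)) ^ k" if k: "1 \<le> k" "k < d" for k
      using rterm_ge_imp_le[OF _ t k(1) order_trans[OF q(2) m_le[OF k]]] q(1) by (simp add: norm1[OF k(1)])
    moreover have "opnorminf M n d (htensor M S X n f) \<le> ereal (t * (1 / sqrt (32 * real q)) ^ d)"
      using rterm_ge_imp_le[OF _ t assms(5) order_trans[OF q(2) m_le_d]] q(1) by simp
    then have "AE x in L.P. W d x \<le> t * (1 / sqrt (32 * real q)) ^ d"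
      using norminf by (auto elim!: eventually_mono dest: order_trans)
    ultimately show ?thesis
      unfolding p_eq W_def using assms(5) by (intro B.two_sided_tail_bound q t) auto
  qed
  define C where "C = 217 * (real d)\<^sup>2"
  have C: "217 \<le> C" using assms(5) by (simp add: C_def)
  have "p \<le> (if m = \<infinity> then 0 else 2 * exp (- real_of_ereal m / C))"
  proof (cases "m = \<infinity>")
    case True
    \<comment> \<open>Every q >= 1 is admissible, so p is at most 2 (1/2)^q for all of them.\<close>
    have "p \<le> 0"
    proof (rule ccontr)
      assume "\<not> p \<le> 0"
      then obtain q where q: "(1 / 2) ^ q < p / 2"
        using real_arch_pow_inv[of "p / 2" "1 / 2"] by auto
      have "p \<le> 2 * (1 / 2) ^ Suc q" using True by (intro tail) auto
      also have "\<dots> \<le> 2 * (1 / 2) ^ q" by simp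
      also have "\<dots> < p" using q by simp
      finally show False by simp
    qed
    then show ?thesis using True by simp
  next
    case False
    show ?thesis
    proof (cases "32 \<le> real_of_ereal m")
      case True
      define x where "x = real_of_ereal m"
      have m: "m = ereal x" using True False by (cases m) (auto simp: x_def)
      have x: "32 \<le> x" using True by (simp add: x_def)
      \<comment> \<open>The largest admissible q; rounding down costs at most a factor 2 because x
        >= 32.\<close>
      define q where "q = nat \<lfloor>x / 32\<rfloor>"
      have q: "1 \<le> q" "32 * real q \<le> x" "x / 32 < real q + 1"
        unfolding q_def using x by linarith+
      then have "x / 64 \<le> real q" by linarith
      have "p \<le> 2 * (1 / 2) ^ q" using q m by (intro tail) auto
      also have "\<dots> \<le> 2 * exp (- x / C)"
        using exp_bound_of_dyadic[OF C x \<open>x / 64 \<le> real q\<close>] by simp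
      finally show ?thesis using m by simp
    next
      case small: False
      \<comment> \<open>Below 32 the claim is trivial: the right side is at least 2 (1 - 32/217) >=
        1.\<close>
      have "real_of_ereal m / C \<le> 32 / C" using small C by (intro divide_right_mono) auto
      also have "\<dots> \<le> 32 / 217" using C by (intro divide_left_mono) auto
      finally have "1 / 2 \<le> 1 + (- real_of_ereal m / C)" by simp
      also have "\<dots> \<le> exp (- real_of_ereal m / C)" by (rule exp_ge_add_one_self)
      finally show ?thesis using p_le_1 False by simp
    qed
  qed
  then show ?thesis unfolding Let_def p_def m_def C_def .
qed

end
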